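(* Let $\alpha,\beta,\sigma$, $\eta=\alpha\beta$, and the continuous linear operator $V=1+\alpha\partial^-$ in $\mathcal E^1_{\mathrm{min}}(\mathbb C)$ (which equals $(1-\alpha D_{\beta-\alpha})^{-1}$) be as in the context. Let $f\in\mathcal E^1_{\mathrm{min}}(\mathbb C)$. If $\alpha=\beta>0$, then $$(Vf)(z)=\int_{(0,\infty)}f(z+x)\,\mu_{\alpha,\alpha,\eta}(dx),\qquad z\in\mathbb C;$$ if $\alpha>\beta>0$, then $$(Vf)(z)=\int_{(\alpha-\beta)\mathbb N_0}\Big(\frac\alpha\beta f(z+x)-\frac{\alpha-\beta}\beta f(z)\Big)\mu_{\alpha,\beta,\eta}(dx),\qquad z\in\mathbb C;$$ and if $\Re(\alpha)\ge0$, $\Im(\alpha)>0$ and $\beta=\overline\alpha$, then $$(Vf)(z)=\int_{\mathbb R}\Big(\frac\alpha\beta f(z+x+\beta)-\frac{\alpha-\beta}\beta f(z)\Big)\mu_{\alpha,\beta,\eta}(dx),\qquad z\in\mathbb C.$$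
   Context: $\mathbb N_0=\{0,1,2,\dots\}$; $(z)^{(n)}=z(z+1)\cdots(z+n-1)$. For $h\ne0$, $(D_hf)(z)=h^{-1}(f(z+h)-f(z))$; $D_0=d/dz$. Parameters: $\sigma>0$, and $\alpha,\beta\in\mathbb C$ satisfy either $\alpha\ge\beta>0$ (then $l=\sigma/\alpha$) or $\Re(\alpha)\ge0$, $\Im(\alpha)>0$, $\beta=\overline\alpha$ (then $l=0$). Put $\lambda=\alpha+\beta$, $\eta=\alpha\beta>0$. $(s_n)_{n\ge0}$ is the monic polynomial sequence with $s_0=1$ and $zs_n(z)=s_{n+1}(z)+(\lambda n+l)s_n(z)+(\sigma n+\eta n(n-1))s_{n-1}(z)$; $\partial^-$ is the linear operator with $\partial^-s_n=ns_{n-1}$, and $V=\alpha\partial^-+1$ on polynomials, extended by continuity to $\mathcal E^1_{\mathrm{min}}(\mathbb C)$. $\mathcal E^1_{\mathrm{min}}(\mathbb C)$ is the space of entire functions $\varphi$ with $\|\varphi\|_t=\sup_{z}|\varphi(z)|e^{-t|z|}<\infty$ for all $t>0$, with the Fréchet topology defined by these norms. The probability measures $\mu_{\alpha,\beta,\tau}$, $\tau>0$ (here used with $\tau=\eta$): - $\alpha=\beta>0$: $\mu_{\alpha,\alpha,\tau}(dx)=\frac1{\Gamma(\tau/\eta)}\alpha^{-\tau/\eta}x^{-1+\tau/\eta}e^{-x/\alpha}dx$ on $(0,\infty)$; - $\alpha>\beta>0$: $\mu_{\alpha,\beta,\tau}=(1-\frac\beta\alpha)^{\tau/\eta}\sum_{n\ge0}(\frac\beta\alpha)^n\frac1{n!}(\frac\tau\eta)^{(n)}\delta_{(\alpha-\beta)n}$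 on $(\alpha-\beta)\mathbb N_0$; - $\Re(\alpha)\ge0$, $\Im(\alpha)>0$, $\beta=\overline\alpha$: $\mu_{\alpha,\beta,\tau}(dx)=C_{\alpha,\beta,\tau}\exp\big((\frac\pi2-\operatorname{Arg}(\alpha))x/\Im(\alpha)\big)\big|\Gamma\big(\frac{ix}{2\Im(\alpha)}+\frac{i\tau\beta}{2\eta\Im(\alpha)}\big)\big|^2dx$ on $\mathbb R$, $\operatorname{Arg}(\alpha)\in(0,\pi/2]$, $C_{\alpha,\beta,\tau}=\frac{(2\cos(\frac\pi2-\operatorname{Arg}(\alpha)))^{\tau/\eta}}{4\Im(\alpha)\pi\Gamma(\tau/\eta)}\exp\big(\frac{(\frac\pi2-\operatorname{Arg}(\alpha))\tau\Re(\alpha)}{\Im(\alpha)\eta}\big)$. *)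

theory Defs
  imports
    "HOL-Complex_Analysis.Complex_Analysis"
    "HOL-Computational_Algebra.Polynomial"
    "HOL-Library.Complex_Order"
begin

definition diffop :: "complex \<Rightarrow> (complex \<Rightarrow> complex) \<Rightarrow> complex \<Rightarrow> complex" where
  "diffop h f z = (if h = 0 then deriv f z else (f (z + h) - f z) / h)"

definition id_minus_diff :: "complex \<Rightarrow> complex \<Rightarrow> (complex \<Rightarrow> complex) \<Rightarrow> complex \<Rightarrow> complex" where
  "id_minus_diff \<alpha> \<beta> f z = f z - \<alpha> * diffop (\<beta> - \<alpha>) f z"

definition E1norm :: "real \<Rightarrow> (complex \<Rightarrow> complex) \<Rightarrow> real" where
  "E1norm t \<phi> = (SUP z. norm (\<phi> z) * exp (- t * norm z))"

definition E1min :: "(complex \<Rightarrow> complex) set" where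
  "E1min = {\<phi>. \<phi> holomorphic_on UNIV \<and>
     (\<forall>t>0. bdd_above (range (\<lambda>z. norm (\<phi> z) * exp (- t * norm z))))}"

definition E1top :: "(complex \<Rightarrow> complex) topology" where
  "E1top = topology_generated_by
     {{\<psi> \<in> E1min. E1norm t (\<lambda>z. \<psi> z - \<phi> z) < \<epsilon>} | t \<phi> \<epsilon>. 0 < t \<and> \<phi> \<in> E1min \<and> 0 < \<epsilon>}"

definition continuous_linear_E1 :: "((complex \<Rightarrow> complex) \<Rightarrow> (complex \<Rightarrow> complex)) \<Rightarrow> bool" where
  "continuous_linear_E1 T \<longleftrightarrow>
     continuous_map E1top E1top T \<and>
     (\<forall>\<phi>\<in>E1min. \<forall>\<psi>\<in>E1min. T (\<lambda>z. \<phi> z + \<psi> z) = (\<lambda>z. T \<phi> z + T \<psi> z)) \<and>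
     (\<forall>c. \<forall>\<phi>\<in>E1min. T (\<lambda>z. c * \<phi> z) = (\<lambda>z. c * T \<phi> z))"

text \<open>\<open>Im \<alpha> = 0\<close> separates the case \<open>\<alpha> \<ge> \<beta> > 0\<close> from the case \<open>Im \<alpha> > 0\<close>.\<close>
definition lpar :: "real \<Rightarrow> complex \<Rightarrow> complex" where
  "lpar \<sigma> \<alpha> = (if Im \<alpha> = 0 then of_real \<sigma> / \<alpha> else 0)"

text \<open>
  The three-term recurrence solved for its leading term. For \<open>n = 0\<close> the coefficient
  of \<open>s (n - 1)\<close> vanishes, so truncated subtraction is harmless.
\<close>
fun s_poly :: "real \<Rightarrow> complex \<Rightarrow> complex \<Rightarrow> nat \<Rightarrow> complex poly" where
  "s_poly \<sigma> \<alpha> \<beta> 0 = 1"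
| "s_poly \<sigma> \<alpha> \<beta> (Suc n) =
     [:0, 1:] * s_poly \<sigma> \<alpha> \<beta> n
     - smult ((\<alpha> + \<beta>) * of_nat n + lpar \<sigma> \<alpha>) (s_poly \<sigma> \<alpha> \<beta> n)
     - smult (of_real \<sigma> * of_nat n + \<alpha> * \<beta> * of_nat n * (of_nat n - 1))
         (s_poly \<sigma> \<alpha> \<beta> (n - 1))"

text \<open>Well defined because the monic sequence \<open>s_poly\<close> is a basis of the polynomials.\<close>
definition lowering :: "real \<Rightarrow> complex \<Rightarrow> complex \<Rightarrow> complex poly \<Rightarrow> complex poly" where
  "lowering \<sigma> \<alpha> \<beta> = (THE L. Vector_Spaces.linear smult smult L \<and>
     (\<forall>n. L (s_poly \<sigma> \<alpha> \<beta> n) = smult (of_nat n) (s_poly \<sigma> \<alpha> \<beta> (n - 1))))"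

text \<open>
  Extension by continuity of \<open>\<alpha> \<partial>\<^sup>- + 1\<close> from polynomials to \<open>E1min\<close>.
  Extensionality fixes the irrelevant values outside \<open>E1min\<close>, making the operator unique.
\<close>
definition Vop :: "real \<Rightarrow> complex \<Rightarrow> complex \<Rightarrow> (complex \<Rightarrow> complex) \<Rightarrow> (complex \<Rightarrow> complex)" where
  "Vop \<sigma> \<alpha> \<beta> = (THE T. T \<in> extensional E1min \<and> continuous_linear_E1 T \<and>
     (\<forall>p. T (poly p) = poly (smult \<alpha> (lowering \<sigma> \<alpha> \<beta> p) + p)))"

text \<open>
  All three families are measures on the Borel sets of the whole real line. For
  real parameters, \<open>Re\<close> is the passage from \<open>complex\<close> to \<open>real\<close>. The discrete measure
  is the image under \<open>n \<mapsto> (\<alpha> - \<beta>) n\<close> of the weights on the natural numbers.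
\<close>
definition mu :: "complex \<Rightarrow> complex \<Rightarrow> real \<Rightarrow> real measure" where
  "mu \<alpha> \<beta> \<tau> =
    (let \<eta> = Re (\<alpha> * \<beta>); a = Re \<alpha>; b = Re \<beta>; \<theta> = pi / 2 - Arg \<alpha> in
     if \<alpha> = \<beta> then
       density lborel (\<lambda>x. ennreal (indicator {0<..} x *
         (1 / Gamma (\<tau> / \<eta>) * a powr (- \<tau> / \<eta>) * x powr (- 1 + \<tau> / \<eta>) * exp (- x / a))))
     else if Im \<alpha> = 0 then
       distr
         (density (count_space (UNIV :: nat set)) (\<lambda>n. ennreal
           ((1 - b / a) powr (\<tau> / \<eta>) * ((b / a) ^ n * (1 / fact n) * pochhammer (\<tau> / \<eta>) n))))
         borel (\<lambda>n. (a - b) * real n)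
     else
       density lborel (\<lambda>x. ennreal (
         (2 * cos \<theta>) powr (\<tau> / \<eta>) / (4 * Im \<alpha> * pi * Gamma (\<tau> / \<eta>))
           * exp (\<theta> * \<tau> * Re \<alpha> / (Im \<alpha> * \<eta>))
         * exp (\<theta> * x / Im \<alpha>)
         * (norm (Gamma (\<i> * of_real x / (2 * of_real (Im \<alpha>))
             + \<i> * of_real \<tau> * \<beta> / (2 * of_real \<eta> * of_real (Im \<alpha>)))))\<^sup>2)))"

end

theory Submission
  imports Defs
begin

text \<open>
  By Cauchy's inequality, \<open>|f\<^sup>(\<^sup>k\<^sup>)(z)| \<le> C (e s)\<^sup>k exp (s |z|)\<close> for every \<open>s > 0\<close>, so any power series
  \<open>F\<close> with positive radius of convergence defines a continuous operator \<open>F(D) = \<Sum>k. F\<^sub>k D\<^sup>k\<close> on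
  \<open>E1min\<close>, and \<open>F \<mapsto> F(D)\<close> is multiplicative. With \<open>h = \<beta> - \<alpha>\<close> and \<open>E(w) = (e\<^sup>h\<^sup>w - 1) / h\<close>
  the operator \<open>1 - \<alpha> D\<^sub>h\<close> is \<open>(1 - \<alpha> E)(D)\<close>, hence invertible. The series \<open>B = E / (1 - \<alpha> E)\<close>
  satisfies \<open>B' = (1 + \<alpha> B) (1 + \<beta> B)\<close>; since \<open>B'(D)\<close> is the commutator of \<open>B(D)\<close> with
  multiplication by \<open>z\<close>, the three-term recurrence yields \<open>B(D) s\<^sub>n = n s\<^sub>n\<^sub>-\<^sub>1\<close>. So \<open>V\<close> agrees with
  \<open>1 + \<alpha> B(D) = (1 - \<alpha> D\<^sub>h)\<^sup>-\<^sup>1\<close> on polynomials, and therefore on \<open>E1min\<close>, because Taylor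
  polynomials converge.

  The integral formulas are checked by inserting \<open>f = (1 - \<alpha> D\<^sub>h) g\<close> with \<open>g = V f\<close>: the integral
  becomes that of a derivative, a telescoping series, or the difference of two integrals along
  parallel lines that enclose a single pole of \<open>1 / cosh\<close>. In the last case Euler's reflection
  formula has turned \<open>|\<Gamma>|\<^sup>2\<close> into \<open>1 / cosh\<close>, as \<open>\<tau> = \<eta>\<close> puts the argument on the line
  \<open>Re = 1/2\<close>.
\<close>

section \<open>Growth estimates and closure properties of \<open>E1min\<close>\<close>

lemma E1min_holomorphic: "f \<in> E1min \<Longrightarrow> f holomorphic_on A"
  unfolding E1min_def using holomorphic_on_subset by blast

lemma E1min_has_field_derivative: "f \<in> E1min \<Longrightarrow> (f has_field_derivative deriv f z) (at z)"
  using E1min_holomorphic[of f UNIV] by (simp add: holomorphic_derivI)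

lemma E1min_norm_le:
  assumes "f \<in> E1min" "t > 0"
  shows "norm (f z) \<le> E1norm t f * exp (t * norm z)"
proof -
  have "norm (f z) * exp (- t * norm z) \<le> E1norm t f"
    unfolding E1norm_def by (rule cSUP_upper) (use assms in \<open>auto simp: E1min_def\<close>)
  then have "norm (f z) * exp (- t * norm z) * exp (t * norm z) \<le> E1norm t f * exp (t * norm z)"
    by (intro mult_right_mono) auto
  then show ?thesis by (simp add: mult.assoc flip: exp_add)
qed

lemma E1norm_le:
  assumes "\<And>z. norm (f z) \<le> C * exp (t * norm z)"
  shows "E1norm t f \<le> C"
  unfolding E1norm_def
proof (rule cSUP_least)
  fix z
  have "norm (f z) * exp (- t * norm z) \<le> C * exp (t * norm z) * exp (- t * norm z)"
    by (intro mult_right_mono assms) auto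
  then show "norm (f z) * exp (- t * norm z) \<le> C" by (simp add: mult.assoc flip: exp_add)
qed auto

lemma E1norm_nonneg: "f \<in> E1min \<Longrightarrow> t > 0 \<Longrightarrow> 0 \<le> E1norm t f"
  using order_trans[OF norm_ge_zero E1min_norm_le[of f t 0]] by simp

text \<open>Lowering the exponent only strengthens a growth bound, so each t may be served by some s
  \<le> t. This slack is what \<open>fps_diff_E1min\<close> relies on, since its series are
  controlled for small exponents only.\<close>

lemma E1minI:
  assumes "f holomorphic_on UNIV"
    and "\<And>t. t > 0 \<Longrightarrow> \<exists>s C. s \<le> t \<and> (\<forall>z. norm (f z) \<le> C * exp (s * norm z))"
  shows "f \<in> E1min"
proof -
  have "bdd_above (range (\<lambda>z. norm (f z) * exp (- t * norm z)))" if t: "t > 0" for t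
  proof -
    obtain s C where s: "s \<le> t" and C: "\<And>z. norm (f z) \<le> C * exp (s * norm z)"
      using assms(2)[OF t] by blast
    have "C \<ge> 0" using order_trans[OF norm_ge_zero C[of 0]] by simp
    have "norm (f z) * exp (- t * norm z) \<le> C" for z
    proof -
      have "norm (f z) * exp (- t * norm z) \<le> C * exp (s * norm z) * exp (- t * norm z)"
        by (intro mult_right_mono C) auto
      also have "\<dots> = C * exp ((s - t) * norm z)"
        by (simp add: mult.assoc algebra_simps flip: exp_add)
      also have "\<dots> \<le> C"
        using s \<open>C \<ge> 0\<close> by (intro mult_left_le) (auto simp: mult_nonpos_nonneg)
      finally show ?thesis .
    qed
    then show ?thesis by (intro bdd_aboveI2)
  qed
  then show ?thesis using assms(1) by (simp add: E1min_def)
qed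

lemma E1norm_antimono:
  assumes "f \<in> E1min" "0 < s" "s \<le> t"
  shows "E1norm t f \<le> E1norm s f"
proof (rule E1norm_le)
  fix z
  have "norm (f z) \<le> E1norm s f * exp (s * norm z)" by (intro E1min_norm_le assms)
  also have "\<dots> \<le> E1norm s f * exp (t * norm z)"
    using assms by (intro mult_left_mono E1norm_nonneg) (auto intro: mult_right_mono)
  finally show "norm (f z) \<le> E1norm s f * exp (t * norm z)" .
qed

lemma E1min_add: 
  assumes "f \<in> E1min" "g \<in> E1min"
  shows "(\<lambda>z. f z + g z) \<in> E1min"
proof (rule E1minI)
  show "(\<lambda>z. f z + g z) holomorphic_on UNIV"
    by (intro holomorphic_intros E1min_holomorphic assms)
  fix t :: real assume t: "t > 0"
  have "norm (f z + g z) \<le> (E1norm t f + E1norm t g) * exp (t * norm z)" for z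
    using norm_triangle_ineq[of "f z" "g z"] E1min_norm_le[OF assms(1) t, of z]
      E1min_norm_le[OF assms(2) t, of z] by (simp add: distrib_right)
  then show "\<exists>s C. s \<le> t \<and> (\<forall>z. norm (f z + g z) \<le> C * exp (s * norm z))" by blast
qed

lemma E1min_cmult: 
  assumes "f \<in> E1min"
  shows "(\<lambda>z. c * f z) \<in> E1min"
proof (rule E1minI)
  show "(\<lambda>z. c * f z) holomorphic_on UNIV"
    by (intro holomorphic_intros E1min_holomorphic assms)
  fix t :: real assume t: "t > 0"
  have "norm (c * f z) \<le> (norm c * E1norm t f) * exp (t * norm z)" for z
    using mult_left_mono[OF E1min_norm_le[OF assms(1) t, of z], of "norm c"]
    by (simp add: norm_mult mult.assoc)
  then show "\<exists>s C. s \<le> t \<and> (\<forall>z. norm (c * f z) \<le> C * exp (s * norm z))" by blast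
qed

lemma E1min_diff: 
  assumes "f \<in> E1min" "g \<in> E1min"
  shows "(\<lambda>z. f z - g z) \<in> E1min"
  using E1min_add[OF assms(1) E1min_cmult[OF assms(2), of "-1"]] by simp

lemma E1min_const: "(\<lambda>z. c) \<in> E1min"
proof (rule E1minI)
  fix t :: real assume "t > 0"
  then have "norm c \<le> norm c * exp (t * norm z)" for z :: complex
    using mult_left_mono[of 1 "exp (t * norm z)" "norm c"] by simp
  then show "\<exists>s C. s \<le> t \<and> (\<forall>z::complex. norm c \<le> C * exp (s * norm z))" by blast
qed simp

text \<open>The factor |z| is absorbed by half of the exponent, because x \<le> exp x at x = t |z| /
  2.\<close>

lemma E1min_mult_id: 
  assumes "f \<in> E1min"
  shows "(\<lambda>z. z * f z) \<in> E1min"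
proof (rule E1minI)
  show "(\<lambda>z. z * f z) holomorphic_on UNIV"
    by (intro holomorphic_intros E1min_holomorphic assms)
  fix t :: real assume t: "t > 0"
  have "norm (z * f z) \<le> (2 / t * E1norm (t/2) f) * exp (t * norm z)" for z
  proof -
    have "t/2 * norm z \<le> exp (t/2 * norm z)" using exp_ge_add_one_self[of "t/2 * norm z"] by linarith
    then have "norm z \<le> 2 / t * exp (t/2 * norm z)" using t by (simp add: field_simps)
    then have "norm z * norm (f z) \<le> (2 / t * exp (t/2 * norm z)) * (E1norm (t/2) f * exp (t/2 * norm z))"
      by (intro mult_mono E1min_norm_le) (use t assms in auto)
    also have "\<dots> = (2 / t * E1norm (t/2) f) * (exp (t/2 * norm z) * exp (t/2 * norm z))"
      by (simp add: ac_simps)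
    also have "exp (t/2 * norm z) * exp (t/2 * norm z) = exp (t * norm z)"
      by (simp flip: exp_add)
    finally show ?thesis by (simp add: norm_mult)
  qed
  then show "\<exists>s C. s \<le> t \<and> (\<forall>z. norm (z * f z) \<le> C * exp (s * norm z))" by blast
qed

lemma E1min_poly: "poly p \<in> E1min"
proof (induction p)
  case 0
  then show ?case using E1min_const[of 0] by (simp add: poly_0 [abs_def])
next
  case (pCons a p)
  then show ?case
    using E1min_add[OF E1min_const[of a] E1min_mult_id[OF pCons.IH]] by simp
qed

section \<open>Cauchy estimates and stability under differentiation\<close>

lemma power_le_fact_exp: 
  fixes x :: real
  assumes "0 \<le> x"
  shows "x ^ k \<le> fact k * exp x"
proof -
  have "(\<Sum>n\<in>{k}. x ^ n /\<^sub>R fact n) \<le> (\<Sum>n. x ^ n /\<^sub>R fact n)"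
    by (rule sum_le_suminf[OF summable_exp_generic]) (use assms in auto)
  then show ?thesis by (simp add: exp_def field_simps)
qed

text \<open>On a circle of radius k / s Cauchy's inequality produces the factor k! exp k. Since k!
  \<le> k^k, dividing by (k / s)^k leaves the geometric factor (e s)^k.\<close>

lemma fact_exp_le: "fact k * exp (real k) \<le> (exp 1 * real k) ^ k"
proof -
  have "(fact k :: real) \<le> real k ^ k" using fact_le_power[of k, where ?'a = real] by simp
  then show ?thesis
    by (simp add: power_mult_distrib flip: exp_of_nat_mult)
qed

text \<open>Cauchy's inequality on the circle of radius \<open>k / s\<close>.\<close>
lemma higher_deriv_bound:
  assumes f: "f \<in> E1min" and s: "s > 0"
  shows "norm ((deriv ^^ k) f z) \<le> E1norm s f * (exp 1 * s) ^ k * exp (s * norm z)"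
proof (cases "k = 0")
  \<comment> \<open>The radius k / s degenerates here, and the claim is the growth bound
    itself.\<close>
  case True
  then show ?thesis using E1min_norm_le[OF f s, of z] by simp
next
  case False
  define r where "r = real k / s"
  have r: "r > 0" using s False by (simp add: r_def)
  let ?B = "E1norm s f * exp (s * (norm z + r))"
  have "norm ((deriv ^^ k) f z) \<le> fact k * ?B / r ^ k"
  proof (rule Cauchy_inequality)
    show "f holomorphic_on ball z r" "0 < r" using E1min_holomorphic[OF f] r by auto
    show "continuous_on (cball z r) f"
      by (intro holomorphic_on_imp_continuous_on E1min_holomorphic f)
    fix w assume w: "norm (z - w) = r"
    have "norm w \<le> norm z + r" using norm_triangle_ineq4[of z "z - w"] w by simp
    then have "E1norm s f * exp (s * norm w) \<le> ?B"
      using s by (intro mult_left_mono E1norm_nonneg f) auto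
    then show "norm (f w) \<le> ?B" using E1min_norm_le[OF f s, of w] by linarith
  qed
  also have "\<dots> = E1norm s f * exp (s * norm z) * (fact k * exp (real k) / r ^ k)"
    using s by (simp add: r_def distrib_left exp_add)
  also have "\<dots> \<le> E1norm s f * exp (s * norm z) * ((exp 1 * real k) ^ k / r ^ k)"
    using r False fact_exp_le[of k] E1norm_nonneg[OF f s]
    by (intro mult_left_mono divide_right_mono) auto
  also have "(exp 1 * real k) ^ k / r ^ k = (exp 1 * s) ^ k"
    using False s by (simp add: r_def flip: power_divide)
  finally show ?thesis
    using E1norm_nonneg[OF f s] by (simp add: ac_simps)
qed

lemma deriv_E1min: 
  assumes "f \<in> E1min"
  shows "deriv f \<in> E1min"
proof (rule E1minI)
  show "deriv f holomorphic_on UNIV"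
    by (intro holomorphic_deriv E1min_holomorphic assms) auto
  fix t :: real assume "t > 0"
  then show "\<exists>s C. s \<le> t \<and> (\<forall>z. norm (deriv f z) \<le> C * exp (s * norm z))"
    using higher_deriv_bound[OF assms, of t 1] by auto
qed

lemma higher_deriv_E1min: "f \<in> E1min \<Longrightarrow> (deriv ^^ k) f \<in> E1min"
  by (induction k) (auto intro: deriv_E1min)

lemma higher_deriv_has_field_derivative:
  "f \<in> E1min \<Longrightarrow> ((deriv ^^ k) f has_field_derivative (deriv ^^ Suc k) f z) (at z)"
  using E1min_has_field_derivative[OF higher_deriv_E1min] by simp

subsection \<open>Power series in the derivative\<close>

text \<open>The operator F(D). Taking the symbol F as a formal power series keeps products, inverses
  and derivatives of symbols algebraic; convergence enters through
  \<open>fps_conv_radius F > 0\<close>.\<close>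

definition fps_diff :: "complex fps \<Rightarrow> (complex \<Rightarrow> complex) \<Rightarrow> complex \<Rightarrow> complex" where
  "fps_diff F f z = (\<Sum>k. fps_nth F k * (deriv ^^ k) f z)"

text \<open>The terms of F(D) f are dominated by |F_k| (e s)^k, so e s has to lie in the disc of
  convergence of F. The conclusion covers all small s, which allows s to be lowered to suit two
  series at once or a prescribed exponent.\<close>

lemma fps_radius_obtain:
  fixes F :: "complex fps"
  assumes "fps_conv_radius F > 0"
  obtains s0 where "s0 > 0"
    "\<And>s. 0 < s \<Longrightarrow> s \<le> s0 \<Longrightarrow> summable (\<lambda>k. norm (fps_nth F k) * (exp 1 * s) ^ k)"
proof -
  obtain r :: real where r: "0 < ereal r" "ereal r < fps_conv_radius F"
    using ereal_dense2[OF assms] by blast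
  show ?thesis
  proof (rule that[of "r / exp 1"])
    show "r / exp 1 > 0" using r by simp
    fix s :: real assume s: "0 < s" "s \<le> r / exp 1"
    then have "exp 1 * s \<le> r" by (simp add: field_simps)
    then have "norm (of_real (exp 1 * s) :: complex) \<le> r"
      using s unfolding norm_of_real by (simp add: abs_mult)
    then have "ereal (norm (of_real (exp 1 * s) :: complex)) < fps_conv_radius F"
      using r by (metis ereal_less_eq(3) order_le_less_trans)
    from norm_summable_fps[OF this] show "summable (\<lambda>k. norm (fps_nth F k) * (exp 1 * s) ^ k)"
      using s by (simp add: norm_mult norm_power power_mult_distrib)
  qed
qed

lemma fps_diff_term_bound:
  assumes "f \<in> E1min" "s > 0"
  shows "norm (fps_nth F k * (deriv ^^ k) f z)
    \<le> E1norm s f * exp (s * norm z) * (norm (fps_nth F k) * (exp 1 * s) ^ k)"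
  using mult_left_mono[OF higher_deriv_bound[OF assms, of k z], of "norm (fps_nth F k)"]
  by (simp add: norm_mult ac_simps)

lemma fps_diff_abs_summable:
  assumes "f \<in> E1min" "fps_conv_radius F > 0"
  shows "summable (\<lambda>k. norm (fps_nth F k * (deriv ^^ k) f z))"
proof -
  obtain s where s: "s > 0" "summable (\<lambda>k. norm (fps_nth F k) * (exp 1 * s) ^ k)"
    using fps_radius_obtain[OF assms(2)] by (metis order_refl)
  show ?thesis
  proof (rule summable_comparison_test'[OF summable_mult[OF s(2), of "E1norm s f * exp (s * norm z)"]])
    fix k :: nat assume "k \<ge> 0"
    show "norm (norm (fps_nth F k * (deriv ^^ k) f z))
      \<le> E1norm s f * exp (s * norm z) * (norm (fps_nth F k) * (exp 1 * s) ^ k)"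
      unfolding real_norm_def abs_norm_cancel by (rule fps_diff_term_bound[OF assms(1) s(1)])
  qed
qed

lemma fps_diff_sums:
  assumes "f \<in> E1min" "fps_conv_radius F > 0"
  shows "(\<lambda>k. fps_nth F k * (deriv ^^ k) f z) sums fps_diff F f z"
  unfolding fps_diff_def by (intro summable_sums summable_norm_cancel[OF fps_diff_abs_summable] assms)

text \<open>For small s, F(D) is bounded with respect to one and the same norm
  \<open>E1norm s\<close> on both sides. Stability of \<open>E1min\<close> and continuity of F(D)
  both follow from this estimate.\<close>

lemma fps_diff_bound:
  assumes "f \<in> E1min" "s > 0" "summable (\<lambda>k. norm (fps_nth F k) * (exp 1 * s) ^ k)"
  shows "norm (fps_diff F f z)
    \<le> (\<Sum>k. norm (fps_nth F k) * (exp 1 * s) ^ k) * E1norm s f * exp (s * norm z)"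
proof -
  let ?g = "\<lambda>k. E1norm s f * exp (s * norm z) * (norm (fps_nth F k) * (exp 1 * s) ^ k)"
  have "norm (fps_diff F f z) \<le> suminf ?g"
    unfolding fps_diff_def
    by (rule norm_suminf_le[OF fps_diff_term_bound summable_mult]) (use assms in auto)
  also have "\<dots> = E1norm s f * exp (s * norm z) * (\<Sum>k. norm (fps_nth F k) * (exp 1 * s) ^ k)"
    by (rule suminf_mult[OF assms(3)])
  finally show ?thesis by (simp add: ac_simps)
qed

text \<open>Termwise differentiation: the derivatives of the terms form the series of F(D) applied
  to f', which converges uniformly by the Weierstrass M-test on a ball having z in its
  interior.\<close>

lemma fps_diff_has_field_derivative:
  assumes f: "f \<in> E1min" and F: "fps_conv_radius F > 0"
  shows "(fps_diff F f has_field_derivative fps_diff F (deriv f) z) (at z)"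
proof -
  obtain s where s: "s > 0" "summable (\<lambda>k. norm (fps_nth F k) * (exp 1 * s) ^ k)"
    using fps_radius_obtain[OF F] by (metis order_refl)
  define R where "R = norm z + 1"
  have "((\<lambda>z. fps_nth F n * (deriv ^^ n) f z) has_field_derivative
          (fps_nth F n * (deriv ^^ n) (deriv f) w)) (at w within ball 0 R)" for n w
    using DERIV_subset[OF DERIV_cmult[OF higher_deriv_has_field_derivative[OF f, of n w]] subset_UNIV]
    by (simp add: funpow_swap1)
  moreover have "summable (\<lambda>n. fps_nth F n * (deriv ^^ n) f z)"
    using fps_diff_sums[OF f F] by (simp add: sums_iff)
  moreover have "uniformly_convergent_on (ball 0 R) (\<lambda>n x. \<Sum>i<n. fps_nth F i * (deriv ^^ i) (deriv f) x)"
  proof (rule Weierstrass_m_test')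
    show "summable (\<lambda>k. E1norm s (deriv f) * exp (s * R) * (norm (fps_nth F k) * (exp 1 * s) ^ k))"
      by (intro summable_mult s)
    fix n x assume "x \<in> ball (0::complex) R"
    then have "exp (s * norm x) \<le> exp (s * R)" using s by simp
    then have "E1norm s (deriv f) * exp (s * norm x) * (norm (fps_nth F n) * (exp 1 * s) ^ n)
      \<le> E1norm s (deriv f) * exp (s * R) * (norm (fps_nth F n) * (exp 1 * s) ^ n)"
      using s by (intro mult_right_mono mult_left_mono E1norm_nonneg deriv_E1min f) auto
    then show "norm (fps_nth F n * (deriv ^^ n) (deriv f) x)
      \<le> E1norm s (deriv f) * exp (s * R) * (norm (fps_nth F n) * (exp 1 * s) ^ n)"
      using fps_diff_term_bound[OF deriv_E1min[OF f] s(1), of F n x] by linarith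
  qed
  moreover have "z \<in> ball 0 R" "z \<in> interior (ball 0 R)" by (simp_all add: R_def)
  ultimately have "((\<lambda>z. \<Sum>k. fps_nth F k * (deriv ^^ k) f z) has_field_derivative
          (\<Sum>k. fps_nth F k * (deriv ^^ k) (deriv f) z)) (at z)"
    using has_field_derivative_series'(2)[where S = "ball 0 R" and ?x0.0 = z and x = z
        and f = "\<lambda>n z. fps_nth F n * (deriv ^^ n) f z" and f' = "\<lambda>n z. fps_nth F n * (deriv ^^ n) (deriv f) z",
        OF convex_ball] by blast
  then show ?thesis unfolding fps_diff_def .
qed

lemma deriv_fps_diff:
  assumes "f \<in> E1min" "fps_conv_radius F > 0"
  shows "deriv (fps_diff F f) = fps_diff F (deriv f)"
  using fps_diff_has_field_derivative[OF assms] by (auto intro: DERIV_imp_deriv)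

lemma higher_deriv_fps_diff:
  assumes "f \<in> E1min" "fps_conv_radius F > 0"
  shows "(deriv ^^ k) (fps_diff F f) = fps_diff F ((deriv ^^ k) f)"
  by (induction k) (use assms in \<open>auto simp: deriv_fps_diff higher_deriv_E1min\<close>)

lemma fps_diff_E1min:
  assumes "f \<in> E1min" "fps_conv_radius F > 0"
  shows "fps_diff F f \<in> E1min"
proof (rule E1minI)
  show "fps_diff F f holomorphic_on UNIV"
    using fps_diff_has_field_derivative[OF assms]
    by (auto simp: holomorphic_on_def field_differentiable_def intro: DERIV_subset)
  fix t :: real assume t: "t > 0"
  obtain s0 where s0: "s0 > 0"
    "\<And>s. 0 < s \<Longrightarrow> s \<le> s0 \<Longrightarrow> summable (\<lambda>k. norm (fps_nth F k) * (exp 1 * s) ^ k)"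
    using fps_radius_obtain[OF assms(2)] by blast
  have "norm (fps_diff F f z) \<le> (\<Sum>k. norm (fps_nth F k) * (exp 1 * min s0 t) ^ k)
      * E1norm (min s0 t) f * exp (min s0 t * norm z)" for z
    by (rule fps_diff_bound) (use assms t s0 in auto)
  moreover have "min s0 t \<le> t" by simp
  ultimately show "\<exists>s C. s \<le> t \<and> (\<forall>z. norm (fps_diff F f z) \<le> C * exp (s * norm z))" by blast
qed

text \<open>A Cauchy product. With one s that suits both F and G, the double series over (k, j)
  converges absolutely; summed by rows it gives F(D) G(D) f, summed by antidiagonals it gives (F
  G)(D) f.\<close>

lemma fps_diff_mult:
  assumes f: "f \<in> E1min" and F: "fps_conv_radius F > 0" and G: "fps_conv_radius G > 0"
  shows "fps_diff F (fps_diff G f) = fps_diff (F * G) f"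
proof
  fix z
  obtain s1 where s1: "s1 > 0"
    "\<And>s. 0 < s \<Longrightarrow> s \<le> s1 \<Longrightarrow> summable (\<lambda>k. norm (fps_nth F k) * (exp 1 * s) ^ k)"
    using fps_radius_obtain[OF F] by blast
  obtain s2 where s2: "s2 > 0"
    "\<And>s. 0 < s \<Longrightarrow> s \<le> s2 \<Longrightarrow> summable (\<lambda>k. norm (fps_nth G k) * (exp 1 * s) ^ k)"
    using fps_radius_obtain[OF G] by blast
  define s where "s = min s1 s2"
  have s: "s > 0" "summable (\<lambda>k. norm (fps_nth F k) * (exp 1 * s) ^ k)"
    "summable (\<lambda>k. norm (fps_nth G k) * (exp 1 * s) ^ k)"
    using s1 s2 by (auto simp: s_def)
  let ?h = "\<lambda>(k, j). fps_nth F k * (fps_nth G j * (deriv ^^ (j + k)) f z)"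
  let ?b = "\<lambda>(k, j). E1norm s f * exp (s * norm z) *
    ((norm (fps_nth F k) * (exp 1 * s) ^ k) * (norm (fps_nth G j) * (exp 1 * s) ^ j))"
  have inner: "(\<lambda>j. fps_nth G j * (deriv ^^ (j + k)) f z) sums fps_diff G ((deriv ^^ k) f) z" for k
    using fps_diff_sums[OF higher_deriv_E1min[OF f] G, of k z] by (simp add: funpow_add)
  have "(\<lambda>p. (norm (fps_nth F (fst p)) * (exp 1 * s) ^ fst p) * (norm (fps_nth G (snd p)) * (exp 1 * s) ^ snd p))
      summable_on UNIV \<times> UNIV"
  proof (rule summable_on_SigmaI)
    have a: "(\<lambda>k. norm (fps_nth F k) * (exp 1 * s) ^ k) summable_on UNIV" 
        "(\<lambda>k. norm (fps_nth G k) * (exp 1 * s) ^ k) summable_on UNIV"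
      using s by (auto intro!: norm_summable_imp_summable_on)
    fix k :: nat
    show "((\<lambda>j. norm (fps_nth F (fst (k, j))) * (exp 1 * s) ^ fst (k, j) *
            (norm (fps_nth G (snd (k, j))) * (exp 1 * s) ^ snd (k, j))) has_sum
        (norm (fps_nth F k) * (exp 1 * s) ^ k * (\<Sum>\<^sub>\<infinity>k. norm (fps_nth G k) * (exp 1 * s) ^ k))) UNIV"
      using has_sum_cmult_right[OF has_sum_infsum[OF a(2)]] by simp
    show "(\<lambda>k. norm (fps_nth F k) * (exp 1 * s) ^ k * (\<Sum>\<^sub>\<infinity>k. norm (fps_nth G k) * (exp 1 * s) ^ k)) summable_on UNIV"
      by (intro summable_on_cmult_left a)
  qed (use s in auto)
  then have "?b summable_on UNIV \<times> UNIV"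
    by (auto simp: case_prod_unfold intro!: summable_on_cmult_right)
  then have "(\<lambda>p. norm (?h p)) summable_on UNIV \<times> UNIV"
  proof (rule summable_on_comparison_test)
    fix p :: "nat \<times> nat"
    obtain k j where p: "p = (k, j)" by fastforce
    have "norm (?h p) = norm (fps_nth F k) * norm (fps_nth G j) * norm ((deriv ^^ (j + k)) f z)"
      by (simp add: p norm_mult)
    also have "\<dots> \<le> norm (fps_nth F k) * norm (fps_nth G j) * 
        (E1norm s f * (exp 1 * s) ^ (j + k) * exp (s * norm z))"
      by (intro mult_left_mono higher_deriv_bound f s) auto
    finally show "norm (?h p) \<le> ?b p" by (simp add: p power_add ac_simps)
  qed auto
  then have summ: "?h summable_on UNIV \<times> UNIV" by (rule abs_summable_summable)
  obtain S where S: "(?h has_sum S) (UNIV \<times> UNIV)" using summ by (auto simp: summable_on_def)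
  have "((\<lambda>k. fps_nth F k * fps_diff G ((deriv ^^ k) f) z) has_sum S) UNIV"
  proof (rule has_sum_SigmaD[OF S])
    fix k :: nat
    have "((\<lambda>j. fps_nth G j * (deriv ^^ (j + k)) f z) has_sum fps_diff G ((deriv ^^ k) f) z) UNIV"
      using norm_summable_imp_has_sum[OF _ inner[of k]]
        fps_diff_abs_summable[OF higher_deriv_E1min[OF f] G, of k z] by (simp add: funpow_add)
    then show "((\<lambda>j. ?h (k, j)) has_sum fps_nth F k * fps_diff G ((deriv ^^ k) f) z) UNIV"
      using has_sum_cmult_right by auto
  qed
  from has_sum_imp_sums[OF this]
  have 1: "(\<lambda>k. fps_nth F k * fps_diff G ((deriv ^^ k) f) z) sums S" .
  \<comment> \<open>Antidiagonals: the pair (n, i) with i \<le> n stands for (k, j) = (i, n -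
    i).\<close>
  have "((\<lambda>p. ?h (snd p, fst p - snd p)) has_sum S) (SIGMA n:UNIV. {..n})
      \<longleftrightarrow> (?h has_sum S) (UNIV \<times> UNIV)"
    by (rule has_sum_reindex_bij_witness[where i = "\<lambda>p. (fst p + snd p, fst p)"
          and j = "\<lambda>p. (snd p, fst p - snd p)"]) auto
  then have "((\<lambda>p. ?h (snd p, fst p - snd p)) has_sum S) (SIGMA n:UNIV. {..n})"
    using S by blast
  then have "((\<lambda>n. \<Sum>i\<le>n. ?h (i, n - i)) has_sum S) UNIV"
    by (rule has_sum_SigmaD) (intro has_sum_finiteI; simp)
  from has_sum_imp_sums[OF this]
  have "(\<lambda>n. fps_nth (F * G) n * (deriv ^^ n) f z) sums S"
    by (simp add: fps_mult_nth atLeast0AtMost sum_distrib_right mult.assoc)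
  then have 2: "fps_diff (F * G) f z = S" by (simp add: fps_diff_def sums_iff)
  show "fps_diff F (fps_diff G f) z = fps_diff (F * G) f z"
    using 1 unfolding 2 by (simp add: fps_diff_def[of F] higher_deriv_fps_diff[OF f G] sums_iff)
qed

lemma fps_diff_const: "fps_diff (fps_const c) f = (\<lambda>z. c * f z)"
proof
  fix z
  have "(\<lambda>k. fps_nth (fps_const c) k * (deriv ^^ k) f z) sums (\<Sum>k\<in>{0}. fps_nth (fps_const c) k * (deriv ^^ k) f z)"
    by (rule sums_finite) auto
  then show "fps_diff (fps_const c) f z = c * f z" by (simp add: fps_diff_def sums_iff)
qed

lemma fps_diff_1: "fps_diff 1 f = f"
  using fps_diff_const[of 1 f] by simp

lemma fps_diff_fps_X: "fps_diff fps_X f = deriv f"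
proof
  fix z
  have "(\<lambda>k. fps_nth fps_X k * (deriv ^^ k) f z) sums (\<Sum>k\<in>{1}. fps_nth fps_X k * (deriv ^^ k) f z)"
    by (rule sums_finite) (auto simp: fps_X_def)
  then show "fps_diff fps_X f z = deriv f z" by (simp add: fps_diff_def sums_iff)
qed

lemma fps_diff_add_fps:
  assumes "f \<in> E1min" "fps_conv_radius F > 0" "fps_conv_radius G > 0"
  shows "fps_diff (F + G) f = (\<lambda>z. fps_diff F f z + fps_diff G f z)"
proof
  fix z
  show "fps_diff (F + G) f z = fps_diff F f z + fps_diff G f z"
    using sums_add[OF fps_diff_sums[OF assms(1,2)] fps_diff_sums[OF assms(1,3)], of z z]
    by (simp add: fps_diff_def sums_iff distrib_right)
qed

lemma fps_diff_cmult_fps: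
  assumes "f \<in> E1min" "fps_conv_radius F > 0"
  shows "fps_diff (fps_const c * F) f = (\<lambda>z. c * fps_diff F f z)"
proof
  fix z
  show "fps_diff (fps_const c * F) f z = c * fps_diff F f z"
    using sums_mult[OF fps_diff_sums[OF assms(1,2)], of c z]
    by (simp add: fps_diff_def sums_iff mult.assoc)
qed

lemma fps_diff_add:
  assumes "f \<in> E1min" "g \<in> E1min" "fps_conv_radius F > 0"
  shows "fps_diff F (\<lambda>z. f z + g z) = (\<lambda>z. fps_diff F f z + fps_diff F g z)"
proof
  fix z
  have "(deriv ^^ k) (\<lambda>z. f z + g z) z = (deriv ^^ k) f z + (deriv ^^ k) g z" for k
    by (rule higher_deriv_add[of _ UNIV]) (auto intro: E1min_holomorphic assms)
  then show "fps_diff F (\<lambda>z. f z + g z) z = fps_diff F f z + fps_diff F g z"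
    using sums_add[OF fps_diff_sums[OF assms(1,3)] fps_diff_sums[OF assms(2,3)], of z z]
    by (simp add: fps_diff_def sums_iff distrib_left)
qed

lemma fps_diff_cmult:
  assumes "f \<in> E1min" "fps_conv_radius F > 0"
  shows "fps_diff F (\<lambda>z. c * f z) = (\<lambda>z. c * fps_diff F f z)"
proof
  fix z
  have "(deriv ^^ k) (\<lambda>z. c * f z) z = c * (deriv ^^ k) f z" for k
    by (rule higher_deriv_cmult[of _ UNIV]) (auto intro: E1min_holomorphic assms)
  then show "fps_diff F (\<lambda>z. c * f z) z = c * fps_diff F f z"
    using sums_mult[OF fps_diff_sums[OF assms(1,2)], of c z]
    by (simp add: fps_diff_def sums_iff mult.left_commute)
qed

lemma fps_diff_diff:
  assumes "f \<in> E1min" "g \<in> E1min" "fps_conv_radius F > 0"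
  shows "fps_diff F (\<lambda>z. f z - g z) = (\<lambda>z. fps_diff F f z - fps_diff F g z)"
  using fps_diff_add[OF assms(1) E1min_cmult[OF assms(2)] assms(3), of "-1"]
    fps_diff_cmult[OF assms(2,3), of "-1"] by simp

lemma higher_deriv_mult_id:
  assumes "f \<in> E1min"
  shows "(deriv ^^ Suc k) (\<lambda>z. z * f z)
    = (\<lambda>z. z * (deriv ^^ Suc k) f z + of_nat (Suc k) * (deriv ^^ k) f z)"
proof (induction k)
  case 0
  show ?case
    by (auto intro!: DERIV_imp_deriv derivative_eq_intros E1min_has_field_derivative assms)
next
  case (Suc k)
  have "deriv (\<lambda>z. z * (deriv ^^ Suc k) f z + of_nat (Suc k) * (deriv ^^ k) f z) z
    = z * (deriv ^^ Suc (Suc k)) f z + of_nat (Suc (Suc k)) * (deriv ^^ Suc k) f z" for z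
    by (rule DERIV_imp_deriv derivative_eq_intros refl
        higher_deriv_has_field_derivative[OF assms])+ (simp add: algebra_simps)
  then show ?case unfolding funpow.simps(2)[of "Suc k" deriv] comp_apply Suc.IH by simp
qed

text \<open>The commutator of F(D) with multiplication by z is F'(D): by the Leibniz rule D^k (z f)
  exceeds z D^k f by k D^(k-1) f. The term k = 0 is split off because the Leibniz rule above is
  stated for \<open>Suc k\<close>.\<close>

lemma fps_diff_mult_id:
  assumes "f \<in> E1min" "fps_conv_radius F > 0"
  shows "fps_diff F (\<lambda>z. z * f z) = (\<lambda>z. z * fps_diff F f z + fps_diff (fps_deriv F) f z)"
proof
  fix z
  have r: "fps_conv_radius (fps_deriv F) > 0"
    using fps_conv_radius_deriv[of F] assms(2) by order
  have "(\<lambda>k. fps_nth F (Suc k) * (deriv ^^ Suc k) (\<lambda>z. z * f z) z) sums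
     (z * (fps_diff F f z - fps_nth F 0 * f z) + fps_diff (fps_deriv F) f z)"
  proof -
    have "(\<lambda>k. fps_nth F (Suc k) * (deriv ^^ Suc k) f z) sums (fps_diff F f z - fps_nth F 0 * f z)"
      using fps_diff_sums[OF assms, of z] by (subst sums_Suc_iff) simp
    from sums_add[OF sums_mult[OF this, of z] fps_diff_sums[OF assms(1) r, of z]]
    show ?thesis
      unfolding higher_deriv_mult_id[OF assms(1)] by (simp add: algebra_simps del: funpow.simps)
  qed
  then have "(\<lambda>k. fps_nth F k * (deriv ^^ k) (\<lambda>z. z * f z) z) sums
     (z * (fps_diff F f z - fps_nth F 0 * f z) + fps_diff (fps_deriv F) f z + fps_nth F 0 * (z * f z))"
    by (subst (asm) sums_Suc_iff) simp
  then show "fps_diff F (\<lambda>z. z * f z) z = z * fps_diff F f z + fps_diff (fps_deriv F) f z"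
    by (simp add: fps_diff_def sums_iff algebra_simps)
qed

text \<open>The series (exp (h w) - 1) / h. Writing it through its coefficients avoids the division
  by h, so that h = 0 yields w, in agreement with \<open>diffop 0\<close> being the
  derivative.\<close>

definition diffop_fps :: "complex \<Rightarrow> complex fps" where
  "diffop_fps h = Abs_fps (\<lambda>n. if n = 0 then 0 else h ^ (n - 1) / fact n)"

lemma diffop_fps_0: "diffop_fps 0 = fps_X"
  by (auto simp: fps_eq_iff diffop_fps_def fps_X_def power_0_left)

lemma diffop_fps_nonzero: "h \<noteq> 0 \<Longrightarrow> diffop_fps h = fps_const (1 / h) * (fps_exp h - 1)"
  by (auto simp: fps_eq_iff diffop_fps_def power_eq_if)

lemma fps_conv_radius_diffop_fps: "fps_conv_radius (diffop_fps h) > 0"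
proof (cases "h = 0")
  case False
  have "fps_conv_radius (fps_exp h - 1) > 0"
    using fps_conv_radius_diff[of "fps_exp h" 1] by (simp add: less_le_trans)
  then show ?thesis using False by (simp add: diffop_fps_nonzero fps_conv_radius_cmult_left)
qed (simp add: diffop_fps_0)

lemma fps_deriv_diffop_fps: "fps_deriv (diffop_fps h) = fps_exp h"
proof -
  have "(1 + of_nat n :: complex) \<noteq> 0" for n by (metis of_nat_Suc of_nat_neq_0)
  then show ?thesis by (auto simp: fps_eq_iff diffop_fps_def divide_simps)
qed

lemma fps_exp_eq_diffop_fps: "fps_exp h = 1 + fps_const h * diffop_fps h"
  by (auto simp: fps_eq_iff diffop_fps_def power_eq_if)

text \<open>Taylor's theorem in the form f (z + h) = exp (h D) f (z). As f is entire, the expansion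
  at z holds on any disc, in particular on one of radius |h| + 1.\<close>

lemma diffop_eq_fps_diff:
  assumes "f \<in> E1min"
  shows "diffop h f = fps_diff (diffop_fps h) f"
proof (cases "h = 0")
  case True
  then show ?thesis by (simp add: diffop_def diffop_fps_0 fps_diff_fps_X fun_eq_iff)
next
  case False
  show ?thesis
  proof
    fix z
    have "(\<lambda>n. (deriv ^^ n) f z / fact n * (z + h - z) ^ n) sums f (z + h)"
      by (rule holomorphic_power_series[where r = "norm h + 1"])
        (auto intro: E1min_holomorphic assms simp: dist_norm)
    then have "(\<lambda>n. fps_nth (fps_exp h) n * (deriv ^^ n) f z) sums f (z + h)"
      by (simp add: mult.commute)
    moreover have "(\<lambda>n. fps_nth 1 n * (deriv ^^ n) f z) sums f z"
      using fps_diff_sums[OF assms, of 1 z] by (simp add: fps_diff_1)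
    ultimately have "(\<lambda>n. 1 / h * (fps_nth (fps_exp h) n * (deriv ^^ n) f z - fps_nth 1 n * (deriv ^^ n) f z))
        sums (1 / h * (f (z + h) - f z))"
      by (intro sums_mult sums_diff)
    then have "(\<lambda>n. fps_nth (diffop_fps h) n * (deriv ^^ n) f z) sums (1 / h * (f (z + h) - f z))"
      unfolding diffop_fps_nonzero[OF False] fps_mult_left_const_nth fps_sub_nth
      by (simp only: left_diff_distrib mult.assoc)
    then show "diffop h f z = fps_diff (diffop_fps h) f z"
      using False by (simp add: diffop_def fps_diff_def sums_iff)
  qed
qed

text \<open>The symbol 1 - \<alpha> E. The sign sits in the constant so that the lemmas on sums and
  constant multiples apply directly.\<close>

definition id_minus_fps :: "complex \<Rightarrow> complex \<Rightarrow> complex fps" where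
  "id_minus_fps \<alpha> \<beta> = 1 + fps_const (- \<alpha>) * diffop_fps (\<beta> - \<alpha>)"

lemma fps_conv_radius_cmult_pos:
  "fps_conv_radius F > 0 \<Longrightarrow> fps_conv_radius (fps_const c * F) > 0" for F :: "complex fps"
  by (cases "c = 0") (simp_all add: fps_conv_radius_cmult_left)

lemma fps_conv_radius_add_pos:
  "fps_conv_radius F > 0 \<Longrightarrow> fps_conv_radius G > 0 \<Longrightarrow> fps_conv_radius (F + G) > 0" for F :: "complex fps"
  by (rule less_le_trans[OF _ fps_conv_radius_add]) simp

lemma fps_conv_radius_mult_pos:
  "fps_conv_radius F > 0 \<Longrightarrow> fps_conv_radius G > 0 \<Longrightarrow> fps_conv_radius (F * G) > 0" for F :: "complex fps"
  by (rule less_le_trans[OF _ fps_conv_radius_mult]) simp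

lemma fps_conv_radius_id_minus_fps: "fps_conv_radius (id_minus_fps \<alpha> \<beta>) > 0"
  unfolding id_minus_fps_def
  by (intro fps_conv_radius_add_pos fps_conv_radius_cmult_pos fps_conv_radius_diffop_fps) simp

lemma fps_nth_0_id_minus_fps: "fps_nth (id_minus_fps \<alpha> \<beta>) 0 = 1"
  by (simp add: id_minus_fps_def diffop_fps_def)

text \<open>E has no constant term, so 1 - \<alpha> E equals 1 at the origin and its reciprocal is
  analytic near 0, possibly on a small disc only.\<close>

lemma fps_conv_radius_inverse_id_minus_fps: "fps_conv_radius (inverse (id_minus_fps \<alpha> \<beta>)) > 0"
  by (rule fps_conv_radius_inverse_pos)
    (simp_all add: fps_nth_0_id_minus_fps fps_conv_radius_id_minus_fps)

lemma inverse_id_minus_fps: "inverse (id_minus_fps \<alpha> \<beta>) * id_minus_fps \<alpha> \<beta> = 1"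
  by (rule inverse_mult_eq_1) (simp add: fps_nth_0_id_minus_fps)

lemma id_minus_diff_eq_fps_diff:
  assumes "f \<in> E1min"
  shows "id_minus_diff \<alpha> \<beta> f = fps_diff (id_minus_fps \<alpha> \<beta>) f"
  unfolding id_minus_fps_def
  by (subst fps_diff_add_fps)
    (simp_all add: assms fps_conv_radius_cmult_pos fps_conv_radius_diffop_fps fps_diff_1
      fps_diff_cmult_fps diffop_eq_fps_diff id_minus_diff_def fun_eq_iff)

lemma fps_diff_inverse_left:
  assumes "f \<in> E1min"
  shows "fps_diff (inverse (id_minus_fps \<alpha> \<beta>)) (id_minus_diff \<alpha> \<beta> f) = f"
  using assms fps_diff_mult[OF assms fps_conv_radius_inverse_id_minus_fps fps_conv_radius_id_minus_fps, of \<alpha> \<beta> \<alpha> \<beta>]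
  by (simp add: id_minus_diff_eq_fps_diff inverse_id_minus_fps fps_diff_1)

lemma id_minus_diff_inverse:
  assumes "f \<in> E1min"
  shows "id_minus_diff \<alpha> \<beta> (fps_diff (inverse (id_minus_fps \<alpha> \<beta>)) f) = f"
  using assms fps_diff_mult[OF assms fps_conv_radius_id_minus_fps fps_conv_radius_inverse_id_minus_fps, of \<alpha> \<beta> \<alpha> \<beta>]
    inverse_id_minus_fps[of \<alpha> \<beta>]
  by (simp add: id_minus_diff_eq_fps_diff fps_diff_E1min fps_conv_radius_inverse_id_minus_fps
      fps_diff_1 mult.commute)

lemma id_minus_diff_E1min: "f \<in> E1min \<Longrightarrow> id_minus_diff \<alpha> \<beta> f \<in> E1min"
  by (simp add: id_minus_diff_eq_fps_diff fps_diff_E1min fps_conv_radius_id_minus_fps)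

lemma bij_betw_id_minus_diff: "bij_betw (id_minus_diff \<alpha> \<beta>) E1min E1min"
  by (rule bij_betwI[where g = "fps_diff (inverse (id_minus_fps \<alpha> \<beta>))"])
    (auto simp: fps_diff_inverse_left id_minus_diff_inverse id_minus_diff_E1min fps_diff_E1min
      fps_conv_radius_inverse_id_minus_fps)

subsection \<open>The lowering operator\<close>

text \<open>The symbol B = E / (1 - \<alpha> E), which will turn out to represent
  \<open>lowering\<close> on polynomials.\<close>

definition lowering_fps :: "complex \<Rightarrow> complex \<Rightarrow> complex fps" where
  "lowering_fps \<alpha> \<beta> = diffop_fps (\<beta> - \<alpha>) * inverse (id_minus_fps \<alpha> \<beta>)"

lemma fps_conv_radius_lowering_fps: "fps_conv_radius (lowering_fps \<alpha> \<beta>) > 0"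
  unfolding lowering_fps_def
  by (intro fps_conv_radius_mult_pos fps_conv_radius_diffop_fps fps_conv_radius_inverse_id_minus_fps)

text \<open>From 1 = (1 - \<alpha> E) / (1 - \<alpha> E). Read as operators, this is why 1 +
  \<alpha> B(D) inverts \<open>id_minus_diff\<close>.\<close>

lemma inverse_id_minus_fps_eq: 
  "inverse (id_minus_fps \<alpha> \<beta>) = 1 + fps_const \<alpha> * lowering_fps \<alpha> \<beta>"
proof -
  have "1 + fps_const \<alpha> * lowering_fps \<alpha> \<beta>
      = inverse (id_minus_fps \<alpha> \<beta>) * id_minus_fps \<alpha> \<beta> + fps_const \<alpha> * lowering_fps \<alpha> \<beta>"
    by (simp add: inverse_id_minus_fps)
  also have "\<dots> = inverse (id_minus_fps \<alpha> \<beta>)"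
    by (simp add: id_minus_fps_def lowering_fps_def algebra_simps flip: fps_const_neg)
  finally show ?thesis by simp
qed

text \<open>With \<open>E = (e\<^sup>h\<^sup>w - 1) / h\<close>, \<open>h = \<beta> - \<alpha>\<close>, the factors \<open>1 + \<alpha> B\<close> and \<open>1 + \<beta> B\<close> of the right-hand
  side are \<open>(1 - \<alpha> E)\<^sup>-\<^sup>1\<close> and \<open>e\<^sup>h\<^sup>w (1 - \<alpha> E)\<^sup>-\<^sup>1\<close>.\<close>
lemma fps_deriv_lowering_fps:
  "fps_deriv (lowering_fps \<alpha> \<beta>) =
    1 + fps_const (\<alpha> + \<beta>) * lowering_fps \<alpha> \<beta> + fps_const (\<alpha> * \<beta>) * (lowering_fps \<alpha> \<beta> * lowering_fps \<alpha> \<beta>)"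
proof -
  define E where "E = diffop_fps (\<beta> - \<alpha>)"
  define J where "J = inverse (id_minus_fps \<alpha> \<beta>)"
  define B where "B = lowering_fps \<alpha> \<beta>"
  define ex where "ex = fps_exp (\<beta> - \<alpha>)"
  have J: "J = 1 + fps_const \<alpha> * B" unfolding J_def B_def by (rule inverse_id_minus_fps_eq)
  have B: "B = E * J" by (simp add: B_def E_def J_def lowering_fps_def)
  have ex: "ex = 1 + fps_const (\<beta> - \<alpha>) * E" unfolding ex_def E_def by (rule fps_exp_eq_diffop_fps)
  have dJ: "fps_deriv J = fps_const \<alpha> * ex * (J * J)"
  proof -
    have "fps_deriv (id_minus_fps \<alpha> \<beta>) = - (fps_const \<alpha> * ex)"
      by (simp add: id_minus_fps_def ex_def fps_deriv_diffop_fps flip: fps_const_neg)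
    then show ?thesis
      unfolding J_def using fps_inverse_deriv[of "id_minus_fps \<alpha> \<beta>"]
      by (simp add: fps_nth_0_id_minus_fps power2_eq_square)
  qed
  have 1: "1 + fps_const \<beta> * B = ex * J"
  proof -
    have "ex * J = J + fps_const (\<beta> - \<alpha>) * B" unfolding ex B by (simp add: algebra_simps)
    also have "\<dots> = 1 + fps_const \<beta> * B" unfolding J by (simp add: algebra_simps flip: fps_const_sub)
    finally show ?thesis by simp
  qed
  \<comment> \<open>Product rule with E' = ex; collecting terms leaves ex J (1 + \<alpha> E
    J).\<close>
  have "fps_deriv B = ex * J + E * (fps_const \<alpha> * ex * (J * J))"
    unfolding B fps_deriv_mult dJ by (simp add: E_def ex_def fps_deriv_diffop_fps)
  also have "\<dots> = ex * J * (1 + fps_const \<alpha> * B)" unfolding B by (simp add: algebra_simps)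
  also have "\<dots> = (1 + fps_const \<beta> * B) * (1 + fps_const \<alpha> * B)" unfolding 1 ..
  also have "\<dots> = 1 + fps_const (\<alpha> + \<beta>) * B + fps_const (\<alpha> * \<beta>) * (B * B)"
    by (simp add: algebra_simps flip: fps_const_add fps_const_mult)
  finally show ?thesis unfolding B_def .
qed

text \<open>Applying B(D) to the recurrence for s_(m+1) produces z B(D) s_m and the commutator B'(D)
  s_m. By the quadratic equation for B' the latter is s_m + (\<alpha> + \<beta>) m s_(m-1) +
  \<alpha> \<beta> m (m - 1) s_(m-2). Once z s_(m-1) is expanded by the recurrence one index lower,
  all terms except (m + 1) s_m cancel.\<close>

lemma fps_diff_lowering_s_poly:
  "fps_diff (lowering_fps \<alpha> \<beta>) (poly (s_poly \<sigma> \<alpha> \<beta> n)) = (\<lambda>z. of_nat n * poly (s_poly \<sigma> \<alpha> \<beta> (n - 1)) z)"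
proof (induction n rule: less_induct)
  case (less n)
  let ?B = "lowering_fps \<alpha> \<beta>" and ?s = "s_poly \<sigma> \<alpha> \<beta>"
  note r = fps_conv_radius_lowering_fps[of \<alpha> \<beta>]
  show ?case
  proof (cases n)
    case 0
    have "poly (?s 0) = poly [:1:]" by (simp add: fun_eq_iff)
    \<comment> \<open>B has no constant term, so B(D) annihilates constants.\<close>
    moreover have "fps_diff ?B (\<lambda>z. 1) = (\<lambda>z. 0)"
    proof
      fix z
      have "(\<lambda>k. fps_nth ?B k * (deriv ^^ k) (\<lambda>z. 1) z) sums (\<Sum>k\<in>{}. fps_nth ?B k * (deriv ^^ k) (\<lambda>z. 1) z)"
        by (rule sums_finite) (auto simp: lowering_fps_def diffop_fps_def)
      then show "fps_diff ?B (\<lambda>z. 1) z = 0" by (simp add: fps_diff_def sums_iff)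
    qed
    ultimately show ?thesis using 0 by (simp add: fun_eq_iff)
  next
    case (Suc m)
    define c where "c = (\<alpha> + \<beta>) * of_nat m + lpar \<sigma> \<alpha>"
    define d where "d = of_real \<sigma> * of_nat m + \<alpha> * \<beta> * of_nat m * (of_nat m - 1)"
    have IH1: "fps_diff ?B (poly (?s m)) = (\<lambda>z. of_nat m * poly (?s (m - 1)) z)"
      using less.IH[of m] Suc by simp
    \<comment> \<open>For m \<le> 1 some indices are truncated; they occur only next to a vanishing
      \<open>of_nat m\<close> or \<open>of_nat (m - 1)\<close>.\<close>
    have IH2: "fps_diff ?B (poly (?s (m - 1))) = (\<lambda>z. of_nat (m - 1) * poly (?s (m - 2)) z)"
      using less.IH[of "m - 1"] Suc by (simp add: numeral_2_eq_2)
    have sn: "poly (?s n) = (\<lambda>z. z * poly (?s m) z - c * poly (?s m) z - d * poly (?s (m - 1)) z)"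
      by (simp add: fun_eq_iff Suc c_def d_def)
    have mem: "(\<lambda>z. c * poly p z) \<in> E1min" for c p
      by (intro E1min_cmult E1min_poly)
    have BB: "fps_diff (?B * ?B) (poly (?s m)) = (\<lambda>z. of_nat m * (of_nat (m - 1) * poly (?s (m - 2)) z))"
      unfolding fps_diff_mult[OF E1min_poly r r, symmetric] IH1 fps_diff_cmult[OF E1min_poly r] IH2 ..
    have dB: "fps_diff (fps_deriv ?B) (poly (?s m)) = (\<lambda>z. poly (?s m) z
        + (\<alpha> + \<beta>) * (of_nat m * poly (?s (m - 1)) z)
        + \<alpha> * \<beta> * (of_nat m * (of_nat (m - 1) * poly (?s (m - 2)) z)))"
      unfolding fps_deriv_lowering_fps
      by (simp add: fps_diff_add_fps fps_diff_cmult_fps E1min_poly r fps_diff_1 IH1 BB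
          fps_conv_radius_add_pos fps_conv_radius_mult_pos fps_conv_radius_cmult_pos)
    have "fps_diff ?B (poly (?s n)) = (\<lambda>z. z * (of_nat m * poly (?s (m - 1)) z)
        + fps_diff (fps_deriv ?B) (poly (?s m)) z - c * (of_nat m * poly (?s (m - 1)) z)
        - d * (of_nat (m - 1) * poly (?s (m - 2)) z))"
      unfolding sn
      by (simp add: fps_diff_diff E1min_diff mem E1min_mult_id E1min_poly r fps_diff_cmult
          fps_diff_mult_id IH1 IH2 del: One_nat_def)
    also have "\<dots> = (\<lambda>z. of_nat n * poly (?s m) z)"
    \<comment> \<open>Only for m = \<open>Suc k\<close> is there a recurrence one index lower that
      rewrites z s_(m-1).\<close>
    proof (cases m)
      case 0
      then show ?thesis unfolding dB by (simp add: Suc)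
    next
      case (Suc k)
      then have "m - 2 = k - 1" by simp
      then show ?thesis
        unfolding dB c_def d_def \<open>n = Suc m\<close> using Suc
        by (simp add: fun_eq_iff algebra_simps)
    qed
    finally have "fps_diff ?B (poly (?s n)) = (\<lambda>z. of_nat n * poly (?s m) z)" .
    moreover have "n - 1 = m" using Suc by simp
    ultimately show ?thesis by (simp only:)
  qed
qed

text \<open>F(D) has to act on \<open>complex poly\<close>, not merely on functions, before it can
  be compared with \<open>lowering\<close>. The induction generalises F, since splitting off a
  factor z brings in F'.\<close>

lemma fps_diff_poly_exists:
  "fps_conv_radius F > 0 \<Longrightarrow> \<exists>q. poly q = fps_diff F (poly p)"
proof (induction p arbitrary: F)
  case 0
  have "fps_diff F (poly 0) = poly 0"
    using fps_diff_cmult[OF E1min_const[of 0] 0, of 0] by (simp add: poly_0 [abs_def])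
  then show ?case by metis
next
  case (pCons a p)
  have r: "fps_conv_radius (fps_deriv F) > 0"
    using fps_conv_radius_deriv[of F] pCons.prems by order
  obtain q1 q2 where q: "poly q1 = fps_diff F (poly p)" "poly q2 = fps_diff (fps_deriv F) (poly p)"
    using pCons.IH pCons.prems r by metis
  have "fps_diff F (\<lambda>z. a) = (\<lambda>z. fps_nth F 0 * a)"
  proof
    fix z
    have "(deriv ^^ k) (\<lambda>z. a) z = (if k = 0 then a else 0)" for k
      by (simp add: higher_deriv_const)
    then have "(\<lambda>k. fps_nth F k * (deriv ^^ k) (\<lambda>z. a) z) sums (\<Sum>k\<in>{0}. fps_nth F k * (deriv ^^ k) (\<lambda>z. a) z)"
      by (intro sums_finite) auto
    then show "fps_diff F (\<lambda>z. a) z = fps_nth F 0 * a" by (simp add: fps_diff_def sums_iff)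
  qed
  moreover have pc: "poly (pCons a p) = (\<lambda>z. a + z * poly p z)" by (simp add: fun_eq_iff)
  ultimately have "fps_diff F (poly (pCons a p)) = poly ([:fps_nth F 0 * a:] + [:0, 1:] * q1 + q2)"
    using fps_diff_add[OF E1min_const[of a] E1min_mult_id[OF E1min_poly[of p]] pCons.prems]
      fps_diff_mult_id[OF E1min_poly[of p] pCons.prems]
    unfolding pc by (simp add: fun_eq_iff q)
  then show ?case by metis
qed

text \<open>Put in terms of coefficients, because \<open>linear_eq_on_s_poly\<close> strips leading
  terms one coefficient at a time.\<close>

lemma coeff_s_poly: "coeff (s_poly \<sigma> \<alpha> \<beta> n) n = 1 \<and> (\<forall>k>n. coeff (s_poly \<sigma> \<alpha> \<beta> n) k = 0)"
proof (induction n rule: less_induct)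
  case (less n)
  show ?case
  proof (cases n)
    case (Suc m)
    have "coeff (s_poly \<sigma> \<alpha> \<beta> m) m = 1" "\<And>k. k > m \<Longrightarrow> coeff (s_poly \<sigma> \<alpha> \<beta> m) k = 0"
      "\<And>k. k > m - 1 \<Longrightarrow> coeff (s_poly \<sigma> \<alpha> \<beta> (m - 1)) k = 0"
      using less.IH[of m] less.IH[of "m - 1"] Suc by auto
    then show ?thesis using Suc by (auto simp: coeff_pCons split: nat.splits)
  qed auto
qed

text \<open>Uniqueness for the description in \<open>lowering\<close>: subtracting the multiple of
  the monic s_n that cancels the coefficient of degree n lowers the degree bound, so the s_n span
  all polynomials.\<close>

lemma linear_eq_on_s_poly:
  assumes "Vector_Spaces.linear smult smult L1" "Vector_Spaces.linear smult smult L2"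
    and "\<And>n. L1 (s_poly \<sigma> \<alpha> \<beta> n) = L2 (s_poly \<sigma> \<alpha> \<beta> n)"
  shows "L1 = L2"
proof
  fix p
  note l1 = assms(1)[unfolded Vector_Spaces.linear_iff] and l2 = assms(2)[unfolded Vector_Spaces.linear_iff]
  have "(\<And>k. k \<ge> n \<Longrightarrow> coeff p k = 0) \<Longrightarrow> L1 p = L2 p" for n
  proof (induction n arbitrary: p)
    case 0
    then have "p = 0" by (simp add: poly_eq_iff)
    moreover have "L1 0 = 0" "L2 0 = 0" using l1 l2 by (metis smult_0_left)+
    ultimately show ?case by simp
  next
    case (Suc n)
    let ?s = "s_poly \<sigma> \<alpha> \<beta> n"
    define q where "q = p - smult (coeff p n) ?s"
    have "coeff q k = 0" if "k \<ge> n" for k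
      using that Suc.prems[of k] coeff_s_poly[of \<sigma> \<alpha> \<beta> n] by (cases "k = n") (auto simp: q_def)
    then have "L1 q = L2 q" by (rule Suc.IH)
    moreover have "p = q + smult (coeff p n) ?s" by (simp add: q_def)
    ultimately show ?case using l1 l2 assms(3)[of n] by metis
  qed
  from this[of "Suc (degree p)"] show "L1 p = L2 p" by (simp add: coeff_eq_0)
qed

text \<open>Existence for the description in \<open>lowering\<close>: B(D) preserves polynomials, is
  linear and shifts the s_n as required, so uniqueness identifies the two.\<close>

lemma poly_lowering:
  "poly (lowering \<sigma> \<alpha> \<beta> p) = fps_diff (lowering_fps \<alpha> \<beta>) (poly p)"
proof -
  note r = fps_conv_radius_lowering_fps[of \<alpha> \<beta>]
  obtain L where L: "\<And>p. poly (L p) = fps_diff (lowering_fps \<alpha> \<beta>) (poly p)"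
    using fps_diff_poly_exists[OF r] by metis
  have vs: "vector_space (smult :: complex \<Rightarrow> _)"
    by unfold_locales (simp_all add: smult_add_right smult_add_left)
  have "L (p + q) = L p + L q" for p q
  proof -
    have "poly (L (p + q)) = poly (L p + L q)"
      unfolding L poly_add using fps_diff_add[OF E1min_poly E1min_poly r, of p q]
      by (simp add: L fun_eq_iff poly_add[abs_def])
    then show ?thesis by (simp add: poly_eq_poly_eq_iff)
  qed
  moreover have "L (smult c p) = smult c (L p)" for c p
  proof -
    have "poly (L (smult c p)) = poly (smult c (L p))"
      using fps_diff_cmult[OF E1min_poly r, of c p]
      by (simp add: L fun_eq_iff poly_smult[abs_def])
    then show ?thesis by (simp add: poly_eq_poly_eq_iff)
  qed
  ultimately have lin: "Vector_Spaces.linear smult smult L"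
    by (simp add: Vector_Spaces.linear_iff vs)
  moreover have "L (s_poly \<sigma> \<alpha> \<beta> n) = smult (of_nat n) (s_poly \<sigma> \<alpha> \<beta> (n - 1))" for n
  proof -
    have "poly (L (s_poly \<sigma> \<alpha> \<beta> n)) = poly (smult (of_nat n) (s_poly \<sigma> \<alpha> \<beta> (n - 1)))"
      by (simp add: L fps_diff_lowering_s_poly fun_eq_iff)
    then show ?thesis by (simp only: poly_eq_poly_eq_iff)
  qed
  ultimately have "lowering \<sigma> \<alpha> \<beta> = L"
    unfolding lowering_def
    by (intro the_equality) (auto intro!: linear_eq_on_s_poly[of _ _ \<sigma> \<alpha> \<beta>])
  then show ?thesis by (simp add: L)
qed

subsection \<open>The topology of \<open>E1min\<close> and the operator \<open>Vop\<close>\<close>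

lemma E1min_ball_openin:
  assumes "0 < t" "\<phi> \<in> E1min" "0 < \<epsilon>"
  shows "openin E1top {\<psi> \<in> E1min. E1norm t (\<lambda>z. \<psi> z - \<phi> z) < \<epsilon>}"
  unfolding E1top_def by (rule topology_generated_by_Basis) (use assms in blast)

lemma E1norm_zero: "E1norm t (\<lambda>z. 0) = 0"
  by (simp add: E1norm_def)

lemma E1norm_triangle:
  assumes "f \<in> E1min" "g \<in> E1min" "h \<in> E1min" "t > 0"
  shows "E1norm t (\<lambda>z. f z - h z) \<le> E1norm t (\<lambda>z. f z - g z) + E1norm t (\<lambda>z. g z - h z)"
proof (rule E1norm_le)
  fix z
  have "norm (f z - h z) \<le> norm (f z - g z) + norm (g z - h z)"
    using norm_triangle_ineq[of "f z - g z" "g z - h z"] by simp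
  then show "norm (f z - h z) \<le> (E1norm t (\<lambda>z. f z - g z) + E1norm t (\<lambda>z. g z - h z)) * exp (t * norm z)"
    using E1min_norm_le[OF E1min_diff[OF assms(1,2)] assms(4), of z]
      E1min_norm_le[OF E1min_diff[OF assms(2,3)] assms(4), of z]
    by (simp add: distrib_right)
qed

lemma topspace_E1top: "topspace E1top = E1min"
proof
  show "topspace E1top \<subseteq> E1min"
    unfolding E1top_def topology_generated_by_topspace by auto
  show "E1min \<subseteq> topspace E1top"
  proof
    fix f assume f: "f \<in> E1min"
    have "f \<in> {\<psi> \<in> E1min. E1norm 1 (\<lambda>z. \<psi> z - f z) < 1}" using f by (simp add: E1norm_zero)
    then show "f \<in> topspace E1top"
      using openin_subset[OF E1min_ball_openin[OF zero_less_one f zero_less_one]] by blast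
  qed
qed

text \<open>The generating balls have arbitrary centres; here they are recentred at f and reduced to
  a single norm. Induction on the generated topology: an intersection is handled by the smaller
  exponent, whose norm is the larger one, and a generator by the triangle inequality.\<close>

lemma E1top_nbhd:
  assumes "openin E1top U" "f \<in> U"
  shows "\<exists>s>0. \<exists>d>0. {\<psi> \<in> E1min. E1norm s (\<lambda>z. \<psi> z - f z) < d} \<subseteq> U"
proof -
  let ?S = "{{\<psi> \<in> E1min. E1norm t (\<lambda>z. \<psi> z - \<phi> z) < \<epsilon>} | t \<phi> \<epsilon>. 0 < t \<and> \<phi> \<in> E1min \<and> 0 < \<epsilon>}"
  have f: "f \<in> E1min" using assms openin_subset[OF assms(1)] by (auto simp: topspace_E1top)
  have "generate_topology_on ?S U"
    using assms(1) unfolding E1top_def by (rule openin_topology_generated_by)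
  then show ?thesis using assms(2)
  proof induction
    case Empty
    then show ?case by simp
  next
    case (Int a b)
    then obtain s1 d1 s2 d2 where *: "s1 > 0" "d1 > 0" "s2 > 0" "d2 > 0"
      "{\<psi> \<in> E1min. E1norm s1 (\<lambda>z. \<psi> z - f z) < d1} \<subseteq> a"
      "{\<psi> \<in> E1min. E1norm s2 (\<lambda>z. \<psi> z - f z) < d2} \<subseteq> b" by blast
    have "{\<psi> \<in> E1min. E1norm (min s1 s2) (\<lambda>z. \<psi> z - f z) < min d1 d2} \<subseteq> a \<inter> b"
    proof
      fix \<psi> assume "\<psi> \<in> {\<psi> \<in> E1min. E1norm (min s1 s2) (\<lambda>z. \<psi> z - f z) < min d1 d2}"
      then have \<psi>: "\<psi> \<in> E1min" "E1norm (min s1 s2) (\<lambda>z. \<psi> z - f z) < min d1 d2" by auto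
      have "E1norm s1 (\<lambda>z. \<psi> z - f z) \<le> E1norm (min s1 s2) (\<lambda>z. \<psi> z - f z)"
        "E1norm s2 (\<lambda>z. \<psi> z - f z) \<le> E1norm (min s1 s2) (\<lambda>z. \<psi> z - f z)"
        using * by (intro E1norm_antimono E1min_diff \<psi> f; simp)+
      then show "\<psi> \<in> a \<inter> b" using * \<psi> by auto
    qed
    moreover have "min s1 s2 > 0" "min d1 d2 > 0" using * by auto
    ultimately show ?case by blast
  next
    case (UN K)
    then show ?case by (meson Union_iff Union_upper order_trans)
  next
    case (Basis s)
    then obtain t \<phi> \<epsilon> where b: "s = {\<psi> \<in> E1min. E1norm t (\<lambda>z. \<psi> z - \<phi> z) < \<epsilon>}" "0 < t" "\<phi> \<in> E1min" "0 < \<epsilon>"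
      by blast
    have "{\<psi> \<in> E1min. E1norm t (\<lambda>z. \<psi> z - f z) < \<epsilon> - E1norm t (\<lambda>z. f z - \<phi> z)} \<subseteq> s"
      using E1norm_triangle[OF _ f b(3) b(2)] unfolding b(1) by force
    moreover have "\<epsilon> - E1norm t (\<lambda>z. f z - \<phi> z) > 0" using Basis.prems b(1) by simp
    ultimately show ?case using b(2) by blast
  qed
qed

text \<open>Continuity in seminorm form: every target norm of a difference is dominated by a
  multiple of some source norm.\<close>

lemma continuous_map_E1top:
  assumes map: "\<And>f. f \<in> E1min \<Longrightarrow> T f \<in> E1min"
    and bound: "\<And>t. t > 0 \<Longrightarrow> \<exists>s>0. \<exists>C\<ge>0. \<forall>f\<in>E1min. \<forall>g\<in>E1min.
      E1norm t (\<lambda>z. T f z - T g z) \<le> C * E1norm s (\<lambda>z. f z - g z)"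
  shows "continuous_map E1top E1top T"
  unfolding continuous_map_def topspace_E1top
proof (intro conjI allI impI)
  fix U assume U: "openin E1top U"
  show "openin E1top {x \<in> E1min. T x \<in> U}"
  proof (subst openin_subopen, intro ballI)
    fix g assume "g \<in> {x \<in> E1min. T x \<in> U}"
    then have g: "g \<in> E1min" "T g \<in> U" by auto
    obtain t d where t: "t > 0" "d > 0" "{\<psi> \<in> E1min. E1norm t (\<lambda>z. \<psi> z - T g z) < d} \<subseteq> U"
      using E1top_nbhd[OF U g(2)] by blast
    obtain s C where s: "s > 0" "C \<ge> 0" "\<And>f. f \<in> E1min \<Longrightarrow>
        E1norm t (\<lambda>z. T f z - T g z) \<le> C * E1norm s (\<lambda>z. f z - g z)"
      using bound[OF t(1)] g(1) by blast
    \<comment> \<open>Dividing by C + 1 instead of C admits C = 0.\<close>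
    let ?V = "{\<psi> \<in> E1min. E1norm s (\<lambda>z. \<psi> z - g z) < d / (C + 1)}"
    have d: "d / (C + 1) > 0" using s t by simp
    have "T f \<in> U" if f: "f \<in> ?V" for f
    proof -
      have "E1norm s (\<lambda>z. f z - g z) \<ge> 0" using f g s by (intro E1norm_nonneg E1min_diff) auto
      then have "C * E1norm s (\<lambda>z. f z - g z) \<le> (C + 1) * E1norm s (\<lambda>z. f z - g z)"
        by (simp add: distrib_right)
      also have "\<dots> < d" using f s by (simp add: field_simps)
      finally have "E1norm t (\<lambda>z. T f z - T g z) < d" using s(3)[of f] f by auto
      then show ?thesis using t(3) map f by auto
    qed
    moreover have "g \<in> ?V" using g d by (simp add: E1norm_zero)
    ultimately show "\<exists>V. openin E1top V \<and> g \<in> V \<and> V \<subseteq> {x \<in> E1min. T x \<in> U}"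
      using E1min_ball_openin[OF s(1) g(1) d] by blast
  qed
qed (use map in auto)

text \<open>\<open>E1norm\<close> decreases in its exponent, so the bound for a small s \<le> t also
  controls \<open>E1norm t\<close>. The restriction matches the extensionality demanded in
  \<open>Vop\<close>.\<close>

lemma continuous_linear_fps_diff:
  assumes F: "fps_conv_radius F > 0"
  shows "continuous_linear_E1 (restrict (fps_diff F) E1min)"
  unfolding continuous_linear_E1_def
proof (intro conjI ballI allI)
  show "continuous_map E1top E1top (restrict (fps_diff F) E1min)"
  proof (rule continuous_map_E1top)
    fix t :: real assume t: "t > 0"
    obtain s0 where s0: "s0 > 0"
      "\<And>s. 0 < s \<Longrightarrow> s \<le> s0 \<Longrightarrow> summable (\<lambda>k. norm (fps_nth F k) * (exp 1 * s) ^ k)"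
      using fps_radius_obtain[OF F] by blast
    define s where "s = min s0 t"
    have s: "s > 0" "s \<le> t" "summable (\<lambda>k. norm (fps_nth F k) * (exp 1 * s) ^ k)"
      using s0 t by (auto simp: s_def)
    let ?C = "\<Sum>k. norm (fps_nth F k) * (exp 1 * s) ^ k"
    have "E1norm t (\<lambda>z. fps_diff F f z - fps_diff F g z) \<le> ?C * E1norm s (\<lambda>z. f z - g z)"
      if fg: "f \<in> E1min" "g \<in> E1min" for f g
    proof -
      have "E1norm t (\<lambda>z. fps_diff F f z - fps_diff F g z) \<le> E1norm s (\<lambda>z. fps_diff F f z - fps_diff F g z)"
        by (intro E1norm_antimono E1min_diff fps_diff_E1min fg F s)
      also have "\<dots> = E1norm s (fps_diff F (\<lambda>z. f z - g z))"
        by (simp add: fps_diff_diff fg F)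
      also have "\<dots> \<le> ?C * E1norm s (\<lambda>z. f z - g z)"
        by (rule E1norm_le) (rule fps_diff_bound[OF E1min_diff[OF fg] s(1,3)])
      finally show ?thesis .
    qed
    moreover have "?C \<ge> 0" using s by (intro suminf_nonneg) auto
    ultimately show "\<exists>s>0. \<exists>C\<ge>0. \<forall>f\<in>E1min. \<forall>g\<in>E1min. 
      E1norm t (\<lambda>z. restrict (fps_diff F) E1min f z - restrict (fps_diff F) E1min g z) \<le> C * E1norm s (\<lambda>z. f z - g z)"
      using s(1) by auto
  qed (simp add: fps_diff_E1min F)
qed (simp_all add: E1min_add E1min_cmult fps_diff_add fps_diff_cmult F)

section \<open>Density of the polynomials and identification of \<open>Vop\<close>\<close>

definition taylor_poly :: "(complex \<Rightarrow> complex) \<Rightarrow> nat \<Rightarrow> complex poly" where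
  "taylor_poly f n = (\<Sum>k<n. monom ((deriv ^^ k) f 0 / fact k) k)"

text \<open>Cauchy's inequality against a single term of the exponential series bounds the k-th
  Taylor term by a multiple of exp (t |z|) / 2^k, so the remainders decay geometrically in
  \<open>E1norm t\<close>.\<close>

lemma E1norm_taylor_poly_tendsto_0:
  assumes f: "f \<in> E1min" and t: "t > 0"
  shows "(\<lambda>n. E1norm t (\<lambda>z. poly (taylor_poly f n) z - f z)) \<longlonglongrightarrow> 0"
proof -
  \<comment> \<open>This makes the Cauchy factor e s equal to t / 2; half of t is left over for the
    geometric decay.\<close>
  define s where "s = t / (2 * exp 1)"
  have s: "s > 0" using t by (simp add: s_def)
  have bound: "norm ((deriv ^^ k) f 0 / fact k * z ^ k) \<le> E1norm s f * exp (t * norm z) * (1/2) ^ k" for k z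
  proof -
    have "norm ((deriv ^^ k) f 0) \<le> E1norm s f * (exp 1 * s) ^ k"
      using higher_deriv_bound[OF f s, of k 0] by simp
    also have "exp 1 * s = t / 2" by (simp add: s_def)
    finally have 1: "norm ((deriv ^^ k) f 0) \<le> E1norm s f * (t / 2) ^ k" .
    have "norm ((deriv ^^ k) f 0 / fact k * z ^ k) = norm ((deriv ^^ k) f 0) * (norm z ^ k / fact k)"
      by (simp add: norm_mult norm_divide norm_power)
    also have "\<dots> \<le> E1norm s f * (t / 2) ^ k * (norm z ^ k / fact k)"
      by (intro mult_right_mono 1) auto
    also have "\<dots> = E1norm s f * (1/2) ^ k * ((t * norm z) ^ k / fact k)"
      by (simp add: power_mult_distrib power_divide)
    also have "\<dots> \<le> E1norm s f * (1/2) ^ k * exp (t * norm z)"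
      using power_le_fact_exp[of "t * norm z" k] t
      by (intro mult_left_mono mult_nonneg_nonneg E1norm_nonneg f s) (auto simp: field_simps)
    finally show ?thesis by (simp add: ac_simps)
  qed
  have le: "E1norm t (\<lambda>z. poly (taylor_poly f n) z - f z) \<le> E1norm s f * 2 * (1/2) ^ n" for n
  proof (rule E1norm_le)
    fix z
    have "(\<lambda>k. (deriv ^^ k) f 0 / fact k * (z - 0) ^ k) sums f z"
      by (rule holomorphic_power_series[where r = "norm z + 1"])
        (auto intro: E1min_holomorphic f)
    then have sm: "summable (\<lambda>k. (deriv ^^ k) f 0 / fact k * z ^ k)"
        "f z = (\<Sum>k. (deriv ^^ k) f 0 / fact k * z ^ k)" by (auto simp: sums_iff)
    have "f z - poly (taylor_poly f n) z = (\<Sum>k. (deriv ^^ (k + n)) f 0 / fact (k + n) * z ^ (k + n))"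
      unfolding sm(2) by (subst suminf_minus_initial_segment[OF sm(1)])
        (simp add: taylor_poly_def poly_sum poly_monom)
    moreover have "norm \<dots> \<le> (\<Sum>k. E1norm s f * exp (t * norm z) * (1/2) ^ n * (1/2) ^ k)"
    proof (rule norm_suminf_le)
      show "summable (\<lambda>k. E1norm s f * exp (t * norm z) * (1/2) ^ n * (1/2) ^ k)"
        by (intro summable_mult summable_geometric) auto
      show "norm ((deriv ^^ (k + n)) f 0 / fact (k + n) * z ^ (k + n))
          \<le> E1norm s f * exp (t * norm z) * (1/2) ^ n * (1/2) ^ k" for k
        using bound[of "k + n" z] by (simp only: power_add ac_simps)
    qed
    moreover have "(\<Sum>k. E1norm s f * exp (t * norm z) * (1/2) ^ n * (1/2) ^ k)
        = E1norm s f * exp (t * norm z) * (1/2) ^ n * 2"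
      by (subst suminf_mult) (auto simp: suminf_geometric intro!: summable_geometric)
    ultimately show "norm (poly (taylor_poly f n) z - f z) \<le> E1norm s f * 2 * (1/2) ^ n * exp (t * norm z)"
      by (simp add: norm_minus_commute ac_simps)
  qed
  show ?thesis
  proof (rule tendsto_sandwich[of "\<lambda>n. 0" _ _ "\<lambda>n. E1norm s f * 2 * (1/2) ^ n"])
    show "(\<lambda>n. E1norm s f * 2 * (1 / 2) ^ n) \<longlonglongrightarrow> 0"
      by (rule tendsto_eq_intros LIMSEQ_realpow_zero refl | simp)+
  qed (use le in \<open>auto intro!: always_eventually E1norm_nonneg E1min_diff E1min_poly f t\<close>)
qed

text \<open>The Taylor polynomials eventually enter every neighbourhood of f, and
  \<open>E1norm 1\<close> controls the value at z. Hence a continuous operator is determined by its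
  values on polynomials.\<close>

lemma continuous_E1top_tendsto:
  assumes T: "continuous_map E1top E1top T" and f: "f \<in> E1min"
  shows "(\<lambda>n. T (poly (taylor_poly f n)) z) \<longlonglongrightarrow> T f z"
proof (rule tendstoI)
  fix e :: real assume e: "e > 0"
  \<comment> \<open>A ball of this radius in \<open>E1norm 1\<close> keeps values at z within
    e.\<close>
  define d where "d = e / exp (norm z)"
  have d: "d > 0" using e by (simp add: d_def)
  have img: "g \<in> E1min \<Longrightarrow> T g \<in> E1min" for g
    using T by (auto simp: continuous_map_def topspace_E1top)
  define U where "U = {\<psi> \<in> E1min. E1norm 1 (\<lambda>z. \<psi> z - T f z) < d}"
  have "openin E1top U" unfolding U_def by (intro E1min_ball_openin img f d) simp
  then have "openin E1top {x \<in> E1min. T x \<in> U}"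
    using T by (auto simp: continuous_map_def topspace_E1top)
  moreover have "f \<in> {x \<in> E1min. T x \<in> U}" using f d img by (simp add: U_def E1norm_zero)
  ultimately obtain s b where s: "s > 0" "b > 0"
      "{\<psi> \<in> E1min. E1norm s (\<lambda>z. \<psi> z - f z) < b} \<subseteq> {x \<in> E1min. T x \<in> U}"
    using E1top_nbhd by blast
  have "\<forall>\<^sub>F n in sequentially. E1norm s (\<lambda>z. poly (taylor_poly f n) z - f z) < b"
    using order_tendstoD(2)[OF E1norm_taylor_poly_tendsto_0[OF f s(1)] s(2)] .
  then show "\<forall>\<^sub>F n in sequentially. dist (T (poly (taylor_poly f n)) z) (T f z) < e"
  proof eventually_elim
    case (elim n)
    then have "poly (taylor_poly f n) \<in> {\<psi> \<in> E1min. E1norm s (\<lambda>z. \<psi> z - f z) < b}"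
      by (simp add: E1min_poly)
    then have "T (poly (taylor_poly f n)) \<in> U" using s(3) by blast
    then have *: "T (poly (taylor_poly f n)) \<in> E1min"
      "E1norm 1 (\<lambda>z. T (poly (taylor_poly f n)) z - T f z) < d" by (auto simp: U_def)
    have "norm (T (poly (taylor_poly f n)) z - T f z)
        \<le> E1norm 1 (\<lambda>z. T (poly (taylor_poly f n)) z - T f z) * exp (1 * norm z)"
      by (rule E1min_norm_le[of "\<lambda>z. T (poly (taylor_poly f n)) z - T f z"]) (auto intro: E1min_diff * img f)
    also have "\<dots> < d * exp (1 * norm z)" using * by (intro mult_strict_right_mono) auto
    finally show ?case by (simp add: d_def dist_norm)
  qed
qed

text \<open>B(D) is the lowering operator on polynomials, so 1 + \<alpha> B(D) meets the description
  of \<open>Vop\<close>. Any other solution agrees with it on Taylor polynomials, hence on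
  \<open>E1min\<close> by passing to the limit, and elsewhere by extensionality.\<close>

lemma Vop_eq_restrict:
  "Vop \<sigma> \<alpha> \<beta> = restrict (fps_diff (inverse (id_minus_fps \<alpha> \<beta>))) E1min" (is "_ = ?T")
  unfolding Vop_def
proof (rule the_equality)
  have poly: "?T (poly p) = poly (smult \<alpha> (lowering \<sigma> \<alpha> \<beta> p) + p)" for p
    by (simp add: E1min_poly inverse_id_minus_fps_eq fps_diff_add_fps fps_diff_cmult_fps
        fps_conv_radius_lowering_fps fps_conv_radius_cmult_pos fps_diff_1 poly_lowering fun_eq_iff)
  then show "?T \<in> extensional E1min \<and> continuous_linear_E1 ?T \<and>
     (\<forall>p. ?T (poly p) = poly (smult \<alpha> (lowering \<sigma> \<alpha> \<beta> p) + p))"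
    by (simp add: continuous_linear_fps_diff fps_conv_radius_inverse_id_minus_fps)
  fix S assume S: "S \<in> extensional E1min \<and> continuous_linear_E1 S \<and>
     (\<forall>p. S (poly p) = poly (smult \<alpha> (lowering \<sigma> \<alpha> \<beta> p) + p))"
  show "S = ?T"
  proof (rule extensionalityI[of _ E1min])
    fix f assume f: "f \<in> E1min"
    show "S f = ?T f"
    proof
      fix z
      have "continuous_map E1top E1top S" "\<And>p. S (poly p) = ?T (poly p)"
        using S poly by (auto simp: continuous_linear_E1_def)
      then have "(\<lambda>n. ?T (poly (taylor_poly f n)) z) \<longlonglongrightarrow> S f z"
        using continuous_E1top_tendsto[of S f z] f by simp
      moreover have "(\<lambda>n. ?T (poly (taylor_poly f n)) z) \<longlonglongrightarrow> ?T f z"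
        using continuous_linear_fps_diff[OF fps_conv_radius_inverse_id_minus_fps]
        unfolding continuous_linear_E1_def by (intro continuous_E1top_tendsto f) (rule conjunct1)
      ultimately show "S f z = ?T f z" by (rule LIMSEQ_unique)
    qed
  qed (use S in auto)
qed

lemma Vop_eq: "f \<in> E1min \<Longrightarrow> Vop \<sigma> \<alpha> \<beta> f = fps_diff (inverse (id_minus_fps \<alpha> \<beta>)) f"
  by (simp add: Vop_eq_restrict)

lemma Vop_E1min: "f \<in> E1min \<Longrightarrow> Vop \<sigma> \<alpha> \<beta> f \<in> E1min"
  by (simp add: Vop_eq fps_diff_E1min fps_conv_radius_inverse_id_minus_fps)

lemma id_minus_diff_Vop: "f \<in> E1min \<Longrightarrow> id_minus_diff \<alpha> \<beta> (Vop \<sigma> \<alpha> \<beta> f) = f"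
  by (simp add: Vop_eq id_minus_diff_inverse)

lemma Vop_eq_inv_into: "f \<in> E1min \<Longrightarrow> Vop \<sigma> \<alpha> \<beta> f = inv_into E1min (id_minus_diff \<alpha> \<beta>) f"
  using inv_into_f_eq[of "id_minus_diff \<alpha> \<beta>" E1min "Vop \<sigma> \<alpha> \<beta> f" f] bij_betw_id_minus_diff[of \<alpha> \<beta>]
  by (simp add: bij_betw_def Vop_E1min id_minus_diff_Vop)

subsection \<open>Integral representations\<close>

lemma E1min_continuous_on_real:
  assumes "f \<in> E1min"
  shows "continuous_on A (\<lambda>x::real. f (z + of_real x))"
proof -
  have "continuous_on UNIV f"
    by (intro holomorphic_on_imp_continuous_on E1min_holomorphic assms)
  then show ?thesis
    by (rule continuous_on_compose2) (auto intro!: continuous_intros)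
qed

lemma E1min_isCont_real: "f \<in> E1min \<Longrightarrow> isCont (\<lambda>x::real. f (z + of_real x)) x"
  using E1min_continuous_on_real[of f UNIV z] by (simp add: continuous_on_eq_continuous_at)

lemma E1min_borel_measurable:
  "f \<in> E1min \<Longrightarrow> (\<lambda>x::real. f (z + of_real x)) \<in> borel_measurable borel"
  by (intro borel_measurable_continuous_onI E1min_continuous_on_real)

lemma integrable_exp_minus_abs:
  fixes c :: real
  assumes c: "c > 0"
  shows "integrable lborel (\<lambda>x. exp (- c * \<bar>x\<bar>))"
proof -
  have "(\<lambda>x. exp (- c * x)) integrable_on {0..}"
    using has_integral_exp_minus_to_infinity[OF c, of 0] by (auto simp: integrable_on_def)
  then have "(\<lambda>x. exp (- c * x)) absolutely_integrable_on {0..}"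
    by (intro nonnegative_absolutely_integrable_1) auto
  then have 1: "integrable lborel (\<lambda>x. indicator {0..} x *\<^sub>R exp (- c * x))"
    unfolding set_integrable_def by (subst (asm) integrable_completion) auto
  \<comment> \<open>The half-line function plus its reflection majorises exp (- c |x|); the origin
    is counted twice.\<close>
  have "integrable lborel (\<lambda>x. indicator {0..} x *\<^sub>R exp (- c * x)
      + indicator {0..} (0 + (-1) * x) *\<^sub>R exp (- c * (0 + (-1) * x)))"
    by (intro Bochner_Integration.integrable_add 1 lborel_integrable_real_affine) simp
  then show ?thesis
    by (rule Bochner_Integration.integrable_bound) (auto simp: indicator_def)
qed

text \<open>The common part of the last two cases. Suppose that integrating (1 - \<alpha> D_h) g,
  with h = \<beta> - \<alpha>, evaluates g at z + h. For g = V f the equation f = (1 - \<alpha> D_h)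
  g reads (\<alpha> - \<beta>) f (z) = \<alpha> g (z + h) - \<beta> g (z), and solving for g (z)
  gives the integrand.\<close>

lemma Vop_integral_representation:
  assumes f: "f \<in> E1min" and ne: "\<alpha> \<noteq> \<beta>" "\<beta> \<noteq> 0"
    and int: "\<And>g. g \<in> E1min \<Longrightarrow> integrable M (\<lambda>x. id_minus_diff \<alpha> \<beta> g (z + of_real x + c)) \<and>
      (LINT x|M. id_minus_diff \<alpha> \<beta> g (z + of_real x + c)) = g (z - (\<alpha> - \<beta>))"
  shows "integrable M (\<lambda>x. \<alpha> / \<beta> * f (z + of_real x + c) - (\<alpha> - \<beta>) / \<beta> * f z) \<and>
    Vop \<sigma> \<alpha> \<beta> f z = (LINT x|M. \<alpha> / \<beta> * f (z + of_real x + c) - (\<alpha> - \<beta>) / \<beta> * f z)"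
proof -
  define g where "g = Vop \<sigma> \<alpha> \<beta> f"
  have g: "g \<in> E1min" "id_minus_diff \<alpha> \<beta> g = f"
    by (simp_all add: g_def Vop_E1min id_minus_diff_Vop f)
  \<comment> \<open>Constants are fixed by 1 - \<alpha> D_h, so the choice g = 1 shows that M has
    total mass 1.\<close>
  have one: "id_minus_diff \<alpha> \<beta> (\<lambda>z. 1) = (\<lambda>z. 1)"
    using ne by (simp add: id_minus_diff_def diffop_def fun_eq_iff)
  have i1: "integrable M (\<lambda>x. 1 :: complex)" "(LINT x|M. (1::complex)) = 1"
    using int[OF E1min_const[of 1]] unfolding one by auto
  have i2: "integrable M (\<lambda>x. f (z + of_real x + c))" "(LINT x|M. f (z + of_real x + c)) = g (z - (\<alpha> - \<beta>))"
    using int[OF g(1)] unfolding g(2) by auto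
  have i3: "integrable M (\<lambda>x. (\<alpha> - \<beta>) / \<beta> * f z)"
    using integrable_mult_right[OF i1(1), of "(\<alpha> - \<beta>) / \<beta> * f z"] by simp
  have i4: "(LINT x|M. (\<alpha> - \<beta>) / \<beta> * f z) = (\<alpha> - \<beta>) / \<beta> * f z"
    using integral_mult_right_zero[of M "(\<alpha> - \<beta>) / \<beta> * f z" "\<lambda>x. 1", unfolded i1(2)]
    by (simp only: mult_1_right)
  have "(LINT x|M. \<alpha> / \<beta> * f (z + of_real x + c) - (\<alpha> - \<beta>) / \<beta> * f z)
      = \<alpha> / \<beta> * g (z - (\<alpha> - \<beta>)) - (\<alpha> - \<beta>) / \<beta> * f z"
    by (subst Bochner_Integration.integral_diff) (use i2 i3 i4 in auto)
  also have "\<dots> = g z"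
  proof -
    have "f z = g z - \<alpha> * ((g (z - (\<alpha> - \<beta>)) - g z) / (\<beta> - \<alpha>))"
      using ne unfolding g(2)[symmetric] id_minus_diff_def diffop_def by (simp add: algebra_simps)
    then have "(\<alpha> - \<beta>) * f z = \<alpha> * g (z - (\<alpha> - \<beta>)) - \<beta> * g z"
      using ne by (simp add: field_simps)
    then show ?thesis using ne by (simp add: divide_simps)
  qed
  finally show ?thesis using i2 i3 by (auto simp: g_def)
qed

subsection \<open>The gamma distribution\<close>

text \<open>For \<tau> = \<eta> the shape parameter is 1 and the gamma distribution becomes the
  exponential one.\<close>

lemma mu_gamma:
  assumes a: "a > 0"
  shows "mu (of_real a) (of_real a) (a * a) =
    density lborel (\<lambda>x. ennreal (indicator {0<..} x * (exp (- x / a) / a)))"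
  using a by (simp add: mu_def Let_def, intro arg_cong[where f = "density lborel"] ext)
    (auto simp: indicator_def powr_minus divide_simps)

text \<open>Here f = g - a g' with g = V f, so exp (- x / a) f (z + x) / a is the derivative of -
  exp (- x / a) g (z + x). The boundary term at 0 gives g (z), and the one at infinity
  vanishes.\<close>

lemma Vop_gamma:
  assumes a: "a > 0" and f: "f \<in> E1min"
  shows "set_integrable (mu (of_real a) (of_real a) (a * a)) {0<..} (\<lambda>x. f (z + of_real x)) \<and>
    Vop \<sigma> (of_real a) (of_real a) f z = (LINT x:{0<..}|mu (of_real a) (of_real a) (a * a). f (z + of_real x))"
proof -
  define g where "g = Vop \<sigma> (of_real a) (of_real a) f"
  have g: "g \<in> E1min" "id_minus_diff (of_real a) (of_real a) g = f"
    by (simp_all add: g_def Vop_E1min id_minus_diff_Vop f)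
  have fg: "f w = g w - of_real a * deriv g w" for w
    unfolding g(2)[symmetric] by (simp add: id_minus_diff_def diffop_def)
  let ?h = "\<lambda>x. (exp (- x / a) / a) *\<^sub>R f (z + of_real x)"
  \<comment> \<open>Half of the decay rate 1 / a: the growth exp (s x) leaves a decay exp (- s
    x).\<close>
  define s where "s = 1 / (2 * a)"
  have s: "s > 0" using a by (simp add: s_def)
  have bound: "norm (exp (- x / a) *\<^sub>R \<phi> (z + of_real x)) \<le> E1norm s \<phi> * exp (s * norm z) * exp (- s * \<bar>x\<bar>)"
    if \<phi>: "\<phi> \<in> E1min" and x: "x \<ge> 0" for \<phi> and x :: real
  proof -
    have "norm (\<phi> (z + of_real x)) \<le> E1norm s \<phi> * exp (s * norm (z + of_real x))"
      by (rule E1min_norm_le[OF \<phi> s])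
    also have "\<dots> \<le> E1norm s \<phi> * exp (s * (norm z + x))"
      using norm_triangle_ineq[of z "of_real x"] x s
      by (intro mult_left_mono E1norm_nonneg \<phi>) auto
    finally have "exp (- x / a) * norm (\<phi> (z + of_real x)) \<le> exp (- x / a) * (E1norm s \<phi> * exp (s * (norm z + x)))"
      by (intro mult_left_mono) auto
    also have "\<dots> = E1norm s \<phi> * exp (s * norm z) * exp (- s * \<bar>x\<bar>)"
      using x a by (simp add: s_def mult_exp_exp field_simps)
    finally show ?thesis by simp
  qed
  have meas: "(\<lambda>x. f (z + of_real x)) \<in> borel_measurable borel"
    by (rule E1min_borel_measurable[OF f])
  have int: "set_integrable lborel {0<..} ?h"
    unfolding set_integrable_def
  proof (rule Bochner_Integration.integrable_bound)
    show "integrable lborel (\<lambda>x. E1norm s f * exp (s * norm z) / a * exp (- s * \<bar>x\<bar>))"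
      by (intro integrable_mult_right integrable_exp_minus_abs s)
    show "(\<lambda>x. indicator {0<..} x *\<^sub>R ?h x) \<in> borel_measurable lborel"
      using meas by measurable
    show "AE x in lborel. norm (indicator {0<..} x *\<^sub>R ?h x)
        \<le> norm (E1norm s f * exp (s * norm z) / a * exp (- s * \<bar>x\<bar>))"
    proof (rule AE_I2)
      fix x :: real
      show "norm (indicator {0<..} x *\<^sub>R ?h x) \<le> norm (E1norm s f * exp (s * norm z) / a * exp (- s * \<bar>x\<bar>))"
      proof (cases "x > 0")
        case True
        then show ?thesis
          using bound[OF f, of x] a E1norm_nonneg[OF f s] by (simp add: divide_right_mono abs_mult)
      qed simp
    qed
  qed
  have "(LBINT x=0..\<infinity>. ?h x) = 0 - (- g z)"
  proof (rule interval_integral_FTC_integrable[where F = "\<lambda>x. - (exp (- x / a) *\<^sub>R g (z + of_real x))"])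
    fix x :: real
    have "((\<lambda>x. g (z + of_real x)) has_vector_derivative deriv g (z + of_real x)) (at x)"
      using E1min_has_field_derivative[OF g(1), of "of_real x + z"]
      unfolding DERIV_shift by (subst (1 2) add.commute) (rule has_vector_derivative_real_field)
    then have "((\<lambda>x. - (exp (- x / a) *\<^sub>R g (z + of_real x))) has_vector_derivative
        - (exp (- x / a) *\<^sub>R deriv g (z + of_real x) + (- 1 / a * exp (- x / a)) *\<^sub>R g (z + of_real x))) (at x)"
      using a by (intro has_vector_derivative_minus has_vector_derivative_scaleR)
        (auto intro!: derivative_eq_intros)
    also have "- (exp (- x / a) *\<^sub>R deriv g (z + of_real x) + (- 1 / a * exp (- x / a)) *\<^sub>R g (z + of_real x)) = ?h x"
      using a by (simp add: fg scaleR_conv_of_real field_simps)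
    finally show "((\<lambda>x. - (exp (- x / a) *\<^sub>R g (z + of_real x))) has_vector_derivative ?h x) (at x)" .
    show "isCont ?h x"
      using a by (intro continuous_intros E1min_isCont_real f) simp_all
  next
    show "set_integrable lborel (einterval 0 \<infinity>) ?h"
      using int by (simp add: zero_ereal_def)
    have "isCont (\<lambda>x. - (exp (- x / a) *\<^sub>R g (z + of_real x))) 0"
      using a by (intro continuous_intros E1min_isCont_real g(1)) simp_all
    then have "((\<lambda>x. - (exp (- x / a) *\<^sub>R g (z + of_real x))) \<longlongrightarrow> - g z) (at_right 0)"
      by (auto simp: isCont_def intro: tendsto_within_subset)
    then show "(((\<lambda>x. - (exp (- x / a) *\<^sub>R g (z + of_real x))) \<circ> real_of_ereal) \<longlongrightarrow> - g z) (at_right 0)"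
      by (simp add: zero_ereal_def ereal_tendsto_simps)
    have "((\<lambda>x. - (exp (- x / a) *\<^sub>R g (z + of_real x))) \<longlongrightarrow> 0) at_top"
    proof (rule Lim_null_comparison)
      show "\<forall>\<^sub>F x in at_top. norm (- (exp (- x / a) *\<^sub>R g (z + of_real x))) \<le> E1norm s g * exp (s * norm z) * exp (- s * x)"
        using eventually_ge_at_top[of 0] by eventually_elim (use bound[OF g(1)] in auto)
      have "((\<lambda>x. exp (- s * x)) \<longlongrightarrow> 0) at_top"
        using s by (intro filterlim_compose[OF exp_at_bot] filterlim_tendsto_neg_mult_at_bot[OF tendsto_const])
          (auto intro: filterlim_ident)
      then show "((\<lambda>x. E1norm s g * exp (s * norm z) * exp (- s * x)) \<longlongrightarrow> 0) at_top"
        by (rule tendsto_mult_right_zero)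
    qed
    then show "(((\<lambda>x. - (exp (- x / a) *\<^sub>R g (z + of_real x))) \<circ> real_of_ereal) \<longlongrightarrow> 0) (at_left \<infinity>)"
      by (simp add: ereal_tendsto_simps)
  qed simp
  then have val: "(LINT x:{0<..}|lborel. ?h x) = g z"
    by (simp add: zero_ereal_def interval_integral_to_infinity_eq)
  \<comment> \<open>The indicator occurs twice, in the density of the measure and in the set
    integral.\<close>
  have w: "(indicator {0<..} x * (exp (- x / a) / a)) *\<^sub>R (indicator {0<..} x *\<^sub>R f (z + of_real x))
      = indicator {0<..} x *\<^sub>R ?h x" for x
    by (simp add: indicator_def)
  have m: "(\<lambda>x. indicator {0<..} x *\<^sub>R f (z + of_real x)) \<in> borel_measurable lborel"
    "(\<lambda>x. indicator {0<..} x * (exp (- x / a) / a)) \<in> borel_measurable lborel"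
    "AE x in lborel. 0 \<le> indicator {0<..} x * (exp (- x / a) / a)"
    using meas a by (auto intro!: AE_I2)
  show ?thesis
    unfolding set_integrable_def set_lebesgue_integral_def mu_gamma[OF a]
      integrable_density[OF m] integral_density[OF m] w
    using int val by (simp add: set_integrable_def set_lebesgue_integral_def g_def)
qed

subsection \<open>The negative binomial distribution\<close>

text \<open>For \<tau> = \<eta> the rising factorial is n!, which leaves geometric weights.\<close>

lemma mu_negative_binomial:
  assumes "0 < b" "b < a"
  shows "mu (of_real a) (of_real b) (a * b) =
    distr (density (count_space UNIV) (\<lambda>n. ennreal ((1 - b / a) * (b / a) ^ n))) borel (\<lambda>n. (a - b) * real n)"
  using assms by (simp add: mu_def Let_def powr_one pochhammer_fact[symmetric])

lemma negative_binomial_integral: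
  fixes h :: "real \<Rightarrow> complex"
  assumes ab: "0 < b" "b < a" and h: "h \<in> borel_measurable borel"
    and summ: "summable (\<lambda>n. norm ((b / a) ^ n *\<^sub>R h ((a - b) * real n)))"
  shows "integrable (mu (of_real a) (of_real b) (a * b)) h \<and>
    (LINT x|mu (of_real a) (of_real b) (a * b). h x) = (1 - b / a) *\<^sub>R (\<Sum>n. (b / a) ^ n *\<^sub>R h ((a - b) * real n))"
proof -
  let ?w = "\<lambda>n. (1 - b / a) * (b / a) ^ n" and ?h = "\<lambda>n. h ((a - b) * real n)"
  let ?N = "density (count_space UNIV) (\<lambda>n. ennreal (?w n))"
  have m: "?h \<in> borel_measurable (count_space UNIV)" "?w \<in> borel_measurable (count_space UNIV)"
    "AE n in count_space UNIV. 0 \<le> ?w n"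
    using ab by (auto intro!: AE_I2 mult_nonneg_nonneg)
  have d: "(\<lambda>n. (a - b) * real n) \<in> ?N \<rightarrow>\<^sub>M borel" by simp
  have eq: "?w n *\<^sub>R ?h n = (1 - b / a) *\<^sub>R ((b / a) ^ n *\<^sub>R ?h n)" for n by simp
  have "summable (\<lambda>n. norm (?w n *\<^sub>R ?h n))"
    using summable_mult[OF summ, of "\<bar>1 - b / a\<bar>"] unfolding eq norm_scaleR[of "1 - b / a"] .
  then have i: "integrable (count_space UNIV) (\<lambda>n. ?w n *\<^sub>R ?h n)"
    by (simp add: integrable_count_space_nat_iff)
  have "(LINT x|mu (of_real a) (of_real b) (a * b). h x) = (\<Sum>n. ?w n *\<^sub>R ?h n)"
    unfolding mu_negative_binomial[OF ab] integral_distr[OF d h] integral_density[OF m]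
    by (rule integral_count_space_nat[OF i])
  also have "\<dots> = (1 - b / a) *\<^sub>R (\<Sum>n. (b / a) ^ n *\<^sub>R ?h n)"
    unfolding eq by (intro suminf_scaleR_right[symmetric] summable_norm_cancel[OF summ])
  finally show ?thesis
    using i unfolding mu_negative_binomial[OF ab] integrable_distr_eq[OF d h] integrable_density[OF m] by simp
qed

lemma geometric_shift_summable:
  assumes g: "g \<in> E1min" and q: "0 < q" "q < 1" and d: "0 < (d::real)"
  shows "summable (\<lambda>n. norm (q ^ n *\<^sub>R g (z + of_real (d * real n))))"
proof -
  \<comment> \<open>With this choice exp (s d) is the inverse square root of q, so the majorant is
    geometric with ratio the square root of q.\<close>
  define s where "s = - ln q / (2 * d)"
  have s: "s > 0" using q d by (auto simp: s_def intro!: divide_neg_pos)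
  have sd: "s * d = - ln q / 2" using d by (simp add: s_def)
  have qs: "0 < q * exp (s * d)" "q * exp (s * d) < 1"
  proof -
    have "q * exp (s * d) = exp (ln q) * exp (- ln q / 2)" using q sd by simp
    also have "\<dots> = exp (ln q / 2)" by (simp flip: exp_add)
    finally show "q * exp (s * d) < 1" using q by simp
  qed (use q in simp)
  show ?thesis
  proof (rule summable_comparison_test')
    show "summable (\<lambda>n. E1norm s g * exp (s * norm z) * (q * exp (s * d)) ^ n)"
      using qs by (intro summable_mult summable_geometric) auto
    fix n :: nat
    have "norm (g (z + of_real (d * real n))) \<le> E1norm s g * exp (s * norm (z + of_real (d * real n)))"
      by (rule E1min_norm_le[OF g s])
    also have "norm (z + of_real (d * real n)) \<le> norm z + d * real n"
      using norm_triangle_ineq[of z "of_real (d * real n)"] d unfolding norm_of_real by simp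
    then have "E1norm s g * exp (s * norm (z + of_real (d * real n))) \<le> E1norm s g * exp (s * (norm z + d * real n))"
      using s by (intro mult_left_mono E1norm_nonneg g) auto
    also have "exp (s * (norm z + d * real n)) = exp (s * norm z) * exp (s * d) ^ n"
      by (simp add: distrib_left exp_add mult.assoc flip: exp_of_nat2_mult)
    finally have "q ^ n * norm (g (z + of_real (d * real n))) \<le> q ^ n * (E1norm s g * (exp (s * norm z) * exp (s * d) ^ n))"
      using q by (intro mult_left_mono) auto
    then show "norm (norm (q ^ n *\<^sub>R g (z + of_real (d * real n)))) \<le> E1norm s g * exp (s * norm z) * (q * exp (s * d)) ^ n"
      using q by (simp add: power_mult_distrib ac_simps)
  qed
qed

text \<open>The shift \<beta> - \<alpha> is one lattice step backwards. Hence the weighted values of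
  (1 - \<alpha> D_h) g on the lattice are differences of consecutive terms, and the series
  telescopes.\<close>

lemma Vop_negative_binomial:
  assumes ab: "0 < b" "b < a" and f: "f \<in> E1min"
  shows "set_integrable (mu (of_real a) (of_real b) (a * b)) (range (\<lambda>n. (a - b) * real n))
      (\<lambda>x. of_real a / of_real b * f (z + of_real x) - (of_real a - of_real b) / of_real b * f z) \<and>
    Vop \<sigma> (of_real a) (of_real b) f z = (LINT x:range (\<lambda>n. (a - b) * real n)|mu (of_real a) (of_real b) (a * b).
      of_real a / of_real b * f (z + of_real x) - (of_real a - of_real b) / of_real b * f z)"
proof -
  let ?M = "mu (of_real a) (of_real b) (a * b)" and ?R = "range (\<lambda>n. (a - b) * real n)"
  let ?h = "\<lambda>x. of_real a / of_real b * f (z + of_real x) - (of_real a - of_real b) / of_real b * f z"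
  have q: "0 < b / a" "b / a < 1" and d: "a - b > 0" using ab by auto
  have key: "integrable ?M (\<lambda>x. id_minus_diff (of_real a) (of_real b) g (z + of_real x + 0)) \<and>
      (LINT x|?M. id_minus_diff (of_real a) (of_real b) g (z + of_real x + 0)) = g (z - (of_real a - of_real b))"
    if g: "g \<in> E1min" for g
  proof -
    let ?k = "id_minus_diff (of_real a) (of_real b) g"
    have k: "?k \<in> E1min" by (rule id_minus_diff_E1min[OF g])
    \<comment> \<open>Starting one lattice step before z makes G 0 the value of g at z - (a - b);
      the factor a / (a - b) below cancels against 1 - b / a.\<close>
    define G where "G n = (b / a) ^ n *\<^sub>R g (z - of_real (a - b) + of_real ((a - b) * real n))" for n
    have step: "(b / a) ^ n *\<^sub>R ?k (z + of_real ((a - b) * real n)) = of_real (a / (a - b)) * (G n - G (Suc n))" for n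
    proof -
      have 1: "z + of_real ((a - b) * real n) + (of_real b - of_real a) = z - of_real (a - b) + of_real ((a - b) * real n)"
        and 2: "z - of_real (a - b) + of_real ((a - b) * real (Suc n)) = z + of_real ((a - b) * real n)"
        by (simp_all add: algebra_simps)
      define g1 g2 where "g1 = g (z - of_real (a - b) + of_real ((a - b) * real n))"
        and "g2 = g (z + of_real ((a - b) * real n))"
      have "?k (z + of_real ((a - b) * real n)) = g2 - of_real a * ((g1 - g2) / (of_real b - of_real a))"
        unfolding id_minus_diff_def diffop_def 1 g1_def g2_def using ab by simp
      also have "\<dots> = of_real (a / (a - b)) * (g1 - of_real (b / a) * g2)"
        using ab by (simp add: divide_simps) (simp add: algebra_simps)
      finally have k: "?k (z + of_real ((a - b) * real n)) = of_real (a / (a - b)) * (g1 - of_real (b / a) * g2)" .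
      show ?thesis
        unfolding k G_def 2 power_Suc g1_def[symmetric] g2_def[symmetric]
        by (simp only: scaleR_conv_of_real of_real_mult right_diff_distrib ac_simps)
    qed
    have "G \<longlonglongrightarrow> 0"
      using summable_LIMSEQ_zero[OF geometric_shift_summable[OF g q d]] unfolding G_def
      by (rule tendsto_norm_zero_cancel)
    then have "(\<lambda>n. G n - G (Suc n)) sums (G 0 - 0)" by (rule telescope_sums')
    from sums_mult[OF this, of "of_real (a / (a - b))"]
    have "(\<Sum>n. (b / a) ^ n *\<^sub>R ?k (z + of_real ((a - b) * real n))) = of_real (a / (a - b)) * G 0"
      unfolding step by (simp add: sums_iff)
    moreover have "(1 - b / a) *\<^sub>R (of_real (a / (a - b)) * G 0) = g (z - (of_real a - of_real b))"
      using ab by (simp add: G_def scaleR_conv_of_real divide_simps)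
    ultimately show ?thesis
      using negative_binomial_integral[OF ab E1min_borel_measurable[OF k, of z] geometric_shift_summable[OF k q d]]
      by simp
  qed
  have ne: "complex_of_real a \<noteq> of_real b" "complex_of_real b \<noteq> 0" using ab by auto
  have rep: "integrable ?M (\<lambda>x. of_real a / of_real b * f (z + of_real x + 0) - (of_real a - of_real b) / of_real b * f z) \<and>
      Vop \<sigma> (of_real a) (of_real b) f z
        = (LINT x|?M. of_real a / of_real b * f (z + of_real x + 0) - (of_real a - of_real b) / of_real b * f z)"
    by (rule Vop_integral_representation[OF f ne key])
  note rep = rep[unfolded add_0_right]
  have R: "?R \<in> sets borel" by (rule sets.countable) simp_all
  \<comment> \<open>The measure is carried by the lattice, so the set integral equals the integral
    over the whole line.\<close>
  have "AE x in ?M. x \<in> ?R"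
    unfolding mu_negative_binomial[OF ab] using R by (simp add: AE_distr_iff) (intro AE_I2 range_eqI[OF refl])
  then have AE: "AE x in ?M. indicator ?R x *\<^sub>R ?h x = ?h x" by eventually_elim simp
  have "sets ?M = sets borel" unfolding mu_negative_binomial[OF ab] by simp
  then have M: "borel_measurable ?M = borel_measurable borel" by (rule measurable_cong_sets) simp
  have m: "(\<lambda>x. indicator ?R x *\<^sub>R ?h x) \<in> borel_measurable ?M" "?h \<in> borel_measurable ?M"
    unfolding M by (intro borel_measurable_scaleR borel_measurable_indicator R borel_measurable_diff
        borel_measurable_times borel_measurable_const E1min_borel_measurable f)+
  show ?thesis
    unfolding set_integrable_def set_lebesgue_integral_def
      integrable_cong_AE[OF m AE] integral_cong_AE[OF m AE] by (rule rep)
qed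

subsection \<open>A contour shift against the hyperbolic secant\<close>

text \<open>Both the zeros of cosh and a lower bound on |cosh| uniform in the imaginary part are
  read off from this split.\<close>

lemma norm_cosh_squared: "(norm (cosh w))\<^sup>2 = (cos (Im w))\<^sup>2 + (sinh (Re w))\<^sup>2" for w :: complex
  using norm_cos_squared[of "\<i> * w"] 
  by (simp add: cosh_conv_cos sinh_field_def exp_minus power_divide)

text \<open>The zeros of cosh lie on the imaginary axis at odd multiples of pi / 2; the neighbours
  of - pi / 2 sit on the boundary of the open strip.\<close>

lemma cosh_eq_0_strip:
  fixes w :: complex
  assumes "cosh w = 0" "- (3 * pi / 2) < Im w" "Im w < pi / 2"
  shows "w = - \<i> * of_real (pi / 2)"
proof -
  have "(cos (Im w))\<^sup>2 + (sinh (Re w))\<^sup>2 = 0" using norm_cosh_squared[of w] assms(1) by simp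
  then have "cos (Im w) = 0" "sinh (Re w) = 0" by (simp_all add: sum_power2_eq_zero_iff)
  then have "sin (Im w + pi / 2) = 0" "Re w = 0" by (simp_all add: sin_add sinh_zero_iff)
  moreover have "Im w + pi / 2 = 0" if "sin (Im w + pi / 2) = 0"
    using sin_eq_0_pi[OF _ _ that] assms by simp
  ultimately show ?thesis by (simp add: complex_eq_iff)
qed

lemma cosh_complex_of_real: "cosh (of_real x) = complex_of_real (cosh x)"
  by (simp add: cosh_field_def flip: exp_of_real)

lemma cosh_minus_i_pi: "cosh (w - \<i> * of_real pi) = - cosh w" for w :: complex
  by (simp add: cosh_conv_cos algebra_simps cos_add)

lemma sinh_ge: "x \<ge> 1 \<Longrightarrow> exp x / 4 \<le> sinh x" for x :: real
proof -
  assume x: "x \<ge> 1"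
  \<comment> \<open>Thus exp (- x) is at most half of exp x, whence the constant 1 / 4.\<close>
  have "2 \<le> exp x * exp x" 
    using mult_mono[OF exp_ge_add_one_self[of x] exp_ge_add_one_self[of x]] x
      mult_mono[of 2 "1 + x" 1 "1 + x"] by simp
  then have "2 * exp (- x) \<le> exp x" by (simp add: exp_minus field_simps)
  then show ?thesis by (simp add: sinh_field_def)
qed

text \<open>The substitution x = 2 R t - R from [0, 1] onto [-R, R]; its derivative 2 R is the
  displacement along the segment.\<close>

lemma has_contour_integral_horizontal:
  fixes H :: "complex \<Rightarrow> complex"
  assumes R: "0 < R" and H: "continuous_on {w. Im w = Im c} H"
  shows "(H has_contour_integral integral {-R..R} (\<lambda>x. H (of_real x + \<i> * of_real (Im c))))
    (linepath (Complex (-R) (Im c)) (Complex R (Im c)))"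
proof -
  let ?y = "\<i> * of_real (Im c)"
  have "continuous_on {-R..R} (\<lambda>x. H (of_real x + ?y))"
    by (rule continuous_on_compose2[OF H]) (auto intro!: continuous_intros)
  then have 1: "((\<lambda>x. H (of_real x + ?y)) has_integral integral {-R..R} (\<lambda>x. H (of_real x + ?y))) (cbox (-R) R)"
    by (simp add: integrable_integral integrable_continuous_real)
  have "((\<lambda>t. H (of_real ((2 * R) *\<^sub>R t + (- R)) + ?y)) has_integral
      (1 / \<bar>2 * R\<bar> ^ DIM(real)) *\<^sub>R integral {-R..R} (\<lambda>x. H (of_real x + ?y)))
      ((\<lambda>x. (1 / (2 * R)) *\<^sub>R x + - ((1 / (2 * R)) *\<^sub>R (- R))) ` cbox (-R) R)"
    using R by (intro has_integral_affinity[OF 1]) auto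
  moreover have "(\<lambda>x. (1 / (2 * R)) *\<^sub>R x + - ((1 / (2 * R)) *\<^sub>R (- R))) ` cbox (-R) R = {0..1}"
    using R by (subst image_affinity_cbox) (simp add: field_simps)
  ultimately have "((\<lambda>t. H (of_real ((2 * R) *\<^sub>R t + (- R)) + ?y) * (2 * R)) has_integral
      (1 / \<bar>2 * R\<bar> ^ DIM(real)) *\<^sub>R integral {-R..R} (\<lambda>x. H (of_real x + ?y)) * (2 * R)) {0..1}"
    by (intro has_integral_mult_left) simp
  moreover have lp: "linepath (Complex (-R) (Im c)) (Complex R (Im c)) t = of_real ((2 * R) *\<^sub>R t + (- R)) + ?y" for t
    by (simp add: linepath_def complex_eq_iff algebra_simps)
  moreover have "Complex R (Im c) - Complex (-R) (Im c) = of_real (2 * R)"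
    by (simp add: complex_eq_iff)
  ultimately show ?thesis
    unfolding has_contour_integral_linepath lp using R by (simp add: scaleR_conv_of_real)
qed

text \<open>Away from the imaginary axis |cosh| is at least sinh (\<kappa> |Re w|) whatever Im w is,
  which makes the bound uniform along the vertical sides of the rectangle below.\<close>

lemma norm_sech_strip_bound:
  fixes N :: "complex \<Rightarrow> complex"
  assumes "\<kappa> > 0" "norm (N w) \<le> C * exp (c * \<bar>Re w\<bar>)" "\<kappa> * \<bar>Re w\<bar> \<ge> 1"
  shows "norm (N w / cosh (of_real \<kappa> * w)) \<le> 4 * C * exp (- (\<kappa> - c) * \<bar>Re w\<bar>)"
proof -
  have "sinh (\<kappa> * \<bar>Re w\<bar>) \<le> norm (cosh (of_real \<kappa> * w))"
  proof (rule power2_le_imp_le)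
    have "(sinh (\<kappa> * \<bar>Re w\<bar>))\<^sup>2 = (sinh (\<kappa> * Re w))\<^sup>2" by (simp add: abs_if)
    also have "\<dots> \<le> (norm (cosh (of_real \<kappa> * w)))\<^sup>2" by (simp add: norm_cosh_squared)
    finally show "(sinh (\<kappa> * \<bar>Re w\<bar>))\<^sup>2 \<le> (norm (cosh (of_real \<kappa> * w)))\<^sup>2" .
  qed simp
  moreover have "exp (\<kappa> * \<bar>Re w\<bar>) / 4 \<le> sinh (\<kappa> * \<bar>Re w\<bar>)" using assms(3) by (rule sinh_ge)
  ultimately have *: "exp (\<kappa> * \<bar>Re w\<bar>) / 4 \<le> norm (cosh (of_real \<kappa> * w))" by linarith
  have "0 \<le> C * exp (c * \<bar>Re w\<bar>)" using assms(2) norm_ge_zero order_trans by blast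
  then have "norm (N w / cosh (of_real \<kappa> * w)) \<le> C * exp (c * \<bar>Re w\<bar>) / (exp (\<kappa> * \<bar>Re w\<bar>) / 4)"
    unfolding norm_divide using * assms(2) by (intro frac_le) auto
  also have "\<dots> = 4 * C * exp (- (\<kappa> - c) * \<bar>Re w\<bar>)"
    by (simp add: left_diff_distrib exp_diff)
  finally show ?thesis .
qed

lemma integrable_over_cosh:
  fixes \<phi> :: "real \<Rightarrow> complex"
  assumes "\<kappa> > 0" "c < \<kappa>" and \<phi>: "continuous_on UNIV \<phi>" "\<And>u. norm (\<phi> u) \<le> C * exp (c * \<bar>u\<bar>)"
  shows "integrable lborel (\<lambda>u. \<phi> u / of_real (cosh (\<kappa> * u)))"
proof (rule Bochner_Integration.integrable_bound)
  show "integrable lborel (\<lambda>u. 2 * C * exp (- (\<kappa> - c) * \<bar>u\<bar>))"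
    using assms by (intro integrable_mult_right integrable_exp_minus_abs) simp
  have "continuous_on UNIV (\<lambda>u. \<phi> u / of_real (cosh (\<kappa> * u)))"
    by (intro continuous_intros \<phi>) auto
  then show "(\<lambda>u. \<phi> u / of_real (cosh (\<kappa> * u))) \<in> borel_measurable lborel"
    using borel_measurable_continuous_onI by simp
  have "norm (\<phi> u / of_real (cosh (\<kappa> * u))) \<le> norm (2 * C * exp (- (\<kappa> - c) * \<bar>u\<bar>))" for u
  proof -
    have C: "C \<ge> 0" using order_trans[OF norm_ge_zero \<phi>(2)[of 0]] by simp
    have "exp (\<kappa> * \<bar>u\<bar>) / 2 \<le> cosh (\<kappa> * \<bar>u\<bar>)" by (simp add: cosh_field_def)
    also have "\<dots> = cosh (\<kappa> * u)" by (simp add: abs_if)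
    finally have "norm (\<phi> u) / cosh (\<kappa> * u) \<le> C * exp (c * \<bar>u\<bar>) / (exp (\<kappa> * \<bar>u\<bar>) / 2)"
      using C by (intro frac_le \<phi>) auto
    also have "\<dots> = 2 * C * exp (- (\<kappa> - c) * \<bar>u\<bar>)"
      by (simp add: left_diff_distrib exp_diff)
    finally show ?thesis using C by (simp add: norm_divide)
  qed
  then show "AE u in lborel. norm (\<phi> u / of_real (cosh (\<kappa> * u))) \<le> norm (2 * C * exp (- (\<kappa> - c) * \<bar>u\<bar>))"
    by (intro AE_I2)
qed

text \<open>Scaling by \<kappa> maps S onto the strip of \<open>cosh_eq_0_strip\<close>, so p is the
  only zero of the denominator in S.\<close>

lemma residue_over_cosh:
  fixes N :: "complex \<Rightarrow> complex" and \<kappa> :: real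
  assumes "\<kappa> > 0" and N: "N holomorphic_on UNIV"
    and S: "S = {w. - (3 * pi / (2 * \<kappa>)) < Im w \<and> Im w < pi / (2 * \<kappa>)}"
    and p: "p = - \<i> * of_real (pi / (2 * \<kappa>))"
  shows "open S" "convex S" "(\<lambda>w. N w / cosh (of_real \<kappa> * w)) holomorphic_on S - {p}"
    "residue (\<lambda>w. N w / cosh (of_real \<kappa> * w)) p = \<i> * N p / of_real \<kappa>"
proof -
  have S': "S = {w. - (3 * pi / (2 * \<kappa>)) < Im w} \<inter> {w. Im w < pi / (2 * \<kappa>)}" by (auto simp: S)
  show o: "open S" unfolding S' by (intro open_Int open_halfspace_Im_gt open_halfspace_Im_lt)
  show "convex S" unfolding S' by (intro convex_Int convex_halfspace_Im_gt convex_halfspace_Im_lt)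
  have nz: "cosh (of_real \<kappa> * w) \<noteq> 0" if "w \<in> S - {p}" for w
  proof
    assume "cosh (of_real \<kappa> * w) = 0"
    then have "of_real \<kappa> * w = - \<i> * of_real (pi / 2)"
      using that assms(1) by (intro cosh_eq_0_strip) (auto simp: S field_simps)
    then have "of_real \<kappa> * w = of_real \<kappa> * p" using assms(1) by (simp add: p field_simps)
    then show False using that assms(1) by simp
  qed
  show h: "(\<lambda>w. N w / cosh (of_real \<kappa> * w)) holomorphic_on S - {p}"
  proof (intro holomorphic_on_divide holomorphic_on_subset[OF N] nz)
    show "(\<lambda>w. cosh (of_real \<kappa> * w)) holomorphic_on S - {p}"
      unfolding cosh_field_def by (intro holomorphic_intros) auto
  qed auto
  have pS: "p \<in> S" using assms(1) by (simp add: S p field_simps)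
  have kp: "of_real \<kappa> * p = - (\<i> * of_real (pi / 2))" using assms(1) by (simp add: p)
  have c0: "cosh (of_real \<kappa> * p) = 0" and s0: "sinh (of_real \<kappa> * p) = - \<i>"
    unfolding kp cosh_minus sinh_minus
    by (simp_all add: cosh_conv_cos sinh_conv_sin sin_of_real cos_of_real del: of_real_divide)
  \<comment> \<open>The difference quotient of the denominator at its zero p has the nonzero limit -
    i \<kappa>; dividing N by this quotient gives the residue.\<close>
  have "((\<lambda>w. cosh (of_real \<kappa> * w)) has_field_derivative sinh (of_real \<kappa> * p) * of_real \<kappa>) (at p)"
    by (auto intro!: derivative_eq_intros)
  then have "((\<lambda>w. cosh (of_real \<kappa> * w) / (w - p)) \<longlongrightarrow> - \<i> * of_real \<kappa>) (at p)"
    unfolding has_field_derivative_iff c0 s0 by simp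
  then have "((\<lambda>w. N w / (cosh (of_real \<kappa> * w) / (w - p))) \<longlongrightarrow> N p / (- \<i> * of_real \<kappa>)) (at p)"
  proof (rule tendsto_divide[rotated])
    have "isCont N p" using N by (metis UNIV_I continuous_on_eq_continuous_at holomorphic_on_imp_continuous_on open_UNIV)
    then show "(N \<longlongrightarrow> N p) (at p)" by (simp add: isCont_def)
  qed (use assms in simp)
  moreover have "N p / (- \<i> * of_real \<kappa>) = \<i> * N p / of_real \<kappa>"
    using assms(1) by (simp add: field_simps)
  ultimately show "residue (\<lambda>w. N w / cosh (of_real \<kappa> * w)) p = \<i> * N p / of_real \<kappa>"
    by (intro residue_simple'[OF o pS h]) simp
qed

text \<open>The residue theorem on the rectangle with horizontal sides at heights 0 and - pi /
  \<kappa>. Lowering w by i pi / \<kappa> changes the sign of cosh (\<kappa> w), so the two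
  oppositely oriented sides combine to a sum over the same denominator. The error is the two
  vertical sides, each of length pi / \<kappa> and bounded by 4 C exp (- (\<kappa> - c) R).\<close>

lemma sech_rectangle:
  fixes N :: "complex \<Rightarrow> complex" and \<kappa> :: real
  assumes \<kappa>: "\<kappa> > 0" and N: "N holomorphic_on UNIV"
    and bound: "\<And>w. \<bar>Im w\<bar> \<le> pi / \<kappa> \<Longrightarrow> norm (N w) \<le> C * exp (c * \<bar>Re w\<bar>)"
    and R: "0 < R" "1 \<le> \<kappa> * R"
  shows "norm (integral {-R..R} (\<lambda>x. (N (of_real x) + N (of_real x - \<i> * of_real (pi / \<kappa>))) / of_real (cosh (\<kappa> * x)))
      - of_real (2 * pi / \<kappa>) * N (- \<i> * of_real (pi / (2 * \<kappa>)))) \<le> 8 * pi / \<kappa> * C * exp (- (\<kappa> - c) * R)"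
proof -
  let ?H = "\<lambda>w. N w / cosh (of_real \<kappa> * w)"
  define m where "m = pi / \<kappa>"
  have m: "m > 0" using \<kappa> by (simp add: m_def)
  define p where "p = - \<i> * of_real (pi / (2 * \<kappa>))"
  define S where "S = {w. - (3 * pi / (2 * \<kappa>)) < Im w \<and> Im w < pi / (2 * \<kappa>)}"
  note res = residue_over_cosh[OF \<kappa> N S_def p_def]
  define a1 a2 a3 a4 where "a1 = Complex (-R) (-m)" and "a2 = Complex R (-m)" and "a3 = Complex R 0"
    and "a4 = Complex (-R) 0"
  \<comment> \<open>S extends by m / 2 beyond the closed strip of the rectangle on either side, and
    p lies at mid-height.\<close>
  have Sbig: "w \<in> S" if "- m \<le> Im w" "Im w \<le> 0" for w
  proof -
    have "3 * pi / (2 * \<kappa>) = 3 / 2 * m" "pi / (2 * \<kappa>) = m / 2" by (simp_all add: m_def)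
    then show ?thesis using that m by (simp add: S_def)
  qed
  have Imp: "Im p = - m / 2" "Re p = 0" by (simp_all add: p_def m_def)
  have cont: "continuous_on A ?H" if "A \<subseteq> S - {p}" for A
    using holomorphic_on_imp_continuous_on[OF res(3)] that by (rule continuous_on_subset)
  have lines: "{w. Im w = 0} \<subseteq> S - {p}" "{w. Im w = - m} \<subseteq> S - {p}"
    using Sbig m Imp by auto
  have sides: "closed_segment a2 a3 \<subseteq> S - {p}" "closed_segment a4 a1 \<subseteq> S - {p}"
    using Sbig m Imp R by (auto simp: closed_segment_same_Re a1_def a2_def a3_def a4_def closed_segment_eq_real_ivl)
  have b: "(?H has_contour_integral integral {-R..R} (\<lambda>x. ?H (of_real x - \<i> * of_real m))) (linepath a1 a2)"
    using has_contour_integral_horizontal[OF R(1), of "Complex 0 (-m)" ?H] cont[OF lines(2)]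
    by (simp add: a1_def a2_def)
  have t: "(?H has_contour_integral - integral {-R..R} (\<lambda>x. ?H (of_real x))) (linepath a3 a4)"
    using has_contour_integral_reverse_linepath[OF has_contour_integral_horizontal[OF R(1), of "0" ?H]] cont[OF lines(1)]
    by (simp add: a3_def a4_def)
  have r: "?H contour_integrable_on linepath a2 a3" and l: "?H contour_integrable_on linepath a4 a1"
    using cont sides by (auto intro: contour_integrable_continuous_linepath)
  have loop: "contour_integral (rectpath a1 a3) ?H = integral {-R..R} (\<lambda>x. ?H (of_real x - \<i> * of_real m))
      + (contour_integral (linepath a2 a3) ?H + (- integral {-R..R} (\<lambda>x. ?H (of_real x)) + contour_integral (linepath a4 a1) ?H))"
    unfolding rectpath_def Let_def
    using has_contour_integral_join[OF b has_contour_integral_join[OF has_contour_integral_integral[OF r]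
        has_contour_integral_join[OF t has_contour_integral_integral[OF l]]]]
    by (intro contour_integral_unique) (simp add: a1_def a2_def a3_def a4_def)
  have loop': "contour_integral (rectpath a1 a3) ?H = 2 * pi * \<i> * (\<Sum>q\<in>{p}. winding_number (rectpath a1 a3) q * residue ?H q)"
  proof (rule Residue_theorem[OF res(1) _ _ res(3)])
    show "connected S" by (rule convex_connected[OF res(2)])
    have sub: "path_image (rectpath a1 a3) \<subseteq> S - {p}"
      using Sbig m Imp R by (subst path_image_rectpath) (auto simp: a1_def a3_def)
    then show "path_image (rectpath a1 a3) \<subseteq> S - {p}" .
    show "\<forall>z. z \<notin> S \<longrightarrow> winding_number (rectpath a1 a3) z = 0"
      using sub by (intro allI impI winding_number_zero_outside[OF _ res(2)]) auto
  qed auto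
  have "winding_number (rectpath a1 a3) p = 1"
    using Imp m R by (intro winding_number_rectpath) (auto simp: a1_def a3_def in_box_complex_iff)
  then have w: "2 * pi * \<i> * (\<Sum>q\<in>{p}. winding_number (rectpath a1 a3) q * residue ?H q) = - (of_real (2 * pi / \<kappa>) * N p)"
  proof -
    have "\<i> * (\<i> * N p) = - N p" by (simp flip: mult.assoc)
    then show ?thesis using \<open>winding_number (rectpath a1 a3) p = 1\<close> res(4) by (simp add: mult.assoc)
  qed
  have main: "integral {-R..R} (\<lambda>x. ?H (of_real x - \<i> * of_real m)) - integral {-R..R} (\<lambda>x. ?H (of_real x))
      + (contour_integral (linepath a2 a3) ?H + contour_integral (linepath a4 a1) ?H) = - (of_real (2 * pi / \<kappa>) * N p)"
    using loop unfolding loop' w by (simp only: diff_conv_add_uminus ac_simps)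
  have shift: "?H (of_real x - \<i> * of_real m) = - (N (of_real x - \<i> * of_real m) / of_real (cosh (\<kappa> * x)))" for x
  proof -
    have "of_real \<kappa> * (of_real x - \<i> * of_real m) = of_real (\<kappa> * x) - \<i> * of_real pi"
      using \<kappa> by (simp add: m_def algebra_simps)
    then show ?thesis by (simp only: cosh_minus_i_pi cosh_complex_of_real divide_minus_right)
  qed
  have real: "?H (of_real x) = N (of_real x) / of_real (cosh (\<kappa> * x))" for x
    by (simp flip: cosh_complex_of_real)
  have ci: "continuous_on A N" for A
    using holomorphic_on_imp_continuous_on[OF N] continuous_on_subset by blast
  have "integral {-R..R} (\<lambda>x. (N (of_real x) + N (of_real x - \<i> * of_real m)) / of_real (cosh (\<kappa> * x)))
    = integral {-R..R} (\<lambda>x. N (of_real x) / of_real (cosh (\<kappa> * x)))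
      + integral {-R..R} (\<lambda>x. N (of_real x - \<i> * of_real m) / of_real (cosh (\<kappa> * x)))"
    unfolding add_divide_distrib
    by (intro Henstock_Kurzweil_Integration.integral_add integrable_continuous_real continuous_intros
        continuous_on_compose2[OF ci[of UNIV]]) auto
  also have "\<dots> = integral {-R..R} (\<lambda>x. ?H (of_real x)) - integral {-R..R} (\<lambda>x. ?H (of_real x - \<i> * of_real m))"
    unfolding shift real by simp
  also have "\<dots> = of_real (2 * pi / \<kappa>) * N p
      + (contour_integral (linepath a2 a3) ?H + contour_integral (linepath a4 a1) ?H)"
    using main by (simp add: algebra_simps add_eq_0_iff2)
  finally have eq: "integral {-R..R} (\<lambda>x. (N (of_real x) + N (of_real x - \<i> * of_real m)) / of_real (cosh (\<kappa> * x)))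
      - of_real (2 * pi / \<kappa>) * N p = contour_integral (linepath a2 a3) ?H + contour_integral (linepath a4 a1) ?H" by simp
  have side: "norm (?H w) \<le> 4 * C * exp (- (\<kappa> - c) * R)" if "\<bar>Re w\<bar> = R" "\<bar>Im w\<bar> \<le> m" for w
    using norm_sech_strip_bound[where N = N and w = w, OF \<kappa> bound] that R by (simp add: m_def)
  have C: "0 \<le> 4 * C * exp (- (\<kappa> - c) * R)"
    using order_trans[OF norm_ge_zero side[of a3]] R m by (simp add: a3_def)
  have "norm (contour_integral (linepath a2 a3) ?H) \<le> 4 * C * exp (- (\<kappa> - c) * R) * norm (a3 - a2)"
    using R m by (intro contour_integral_bound_linepath r C side)
      (auto simp: closed_segment_same_Re a1_def a2_def a3_def a4_def closed_segment_eq_real_ivl)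
  moreover have "norm (contour_integral (linepath a4 a1) ?H) \<le> 4 * C * exp (- (\<kappa> - c) * R) * norm (a1 - a4)"
    using R m by (intro contour_integral_bound_linepath l C side)
      (auto simp: closed_segment_same_Re a1_def a2_def a3_def a4_def closed_segment_eq_real_ivl)
  moreover have "norm (a3 - a2) = m" "norm (a1 - a4) = m"
    using m by (simp_all add: a1_def a2_def a3_def a4_def cmod_def)
  ultimately have "norm (contour_integral (linepath a2 a3) ?H + contour_integral (linepath a4 a1) ?H)
      \<le> 2 * (4 * C * exp (- (\<kappa> - c) * R) * m)"
    using norm_triangle_ineq[of "contour_integral (linepath a2 a3) ?H" "contour_integral (linepath a4 a1) ?H"] by simp
  then show ?thesis unfolding eq[symmetric] by (simp add: m_def p_def ac_simps)
qed

text \<open>The limit of \<open>sech_rectangle\<close> as R tends to infinity: since c < \<kappa>,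
  the integrand is absolutely integrable and the error term vanishes.\<close>

lemma sech_integral:
  fixes N :: "complex \<Rightarrow> complex" and \<kappa> :: real
  assumes \<kappa>: "\<kappa> > 0" and c: "c < \<kappa>" and N: "N holomorphic_on UNIV"
    and bound: "\<And>w. \<bar>Im w\<bar> \<le> pi / \<kappa> \<Longrightarrow> norm (N w) \<le> C * exp (c * \<bar>Re w\<bar>)"
  shows "integrable lborel (\<lambda>x. (N (of_real x) + N (of_real x - \<i> * of_real (pi / \<kappa>))) / of_real (cosh (\<kappa> * x))) \<and>
    (LINT x|lborel. (N (of_real x) + N (of_real x - \<i> * of_real (pi / \<kappa>))) / of_real (cosh (\<kappa> * x)))
      = of_real (2 * pi / \<kappa>) * N (- \<i> * of_real (pi / (2 * \<kappa>)))"
proof -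
  let ?F = "\<lambda>x. (N (of_real x) + N (of_real x - \<i> * of_real (pi / \<kappa>))) / of_real (cosh (\<kappa> * x))"
  let ?L = "of_real (2 * pi / \<kappa>) * N (- \<i> * of_real (pi / (2 * \<kappa>)))"
  have ci: "continuous_on UNIV N"
    using holomorphic_on_imp_continuous_on[OF N] .
  have int: "integrable lborel ?F"
  proof (rule integrable_over_cosh[OF \<kappa> c, of _ "2 * C"])
    show "continuous_on UNIV (\<lambda>x. N (of_real x) + N (of_real x - \<i> * of_real (pi / \<kappa>)))"
      by (intro continuous_intros continuous_on_compose2[OF ci]) auto
    fix u :: real
    have "norm (N (of_real u)) \<le> C * exp (c * \<bar>u\<bar>)" using bound[of "of_real u"] \<kappa> by simp
    moreover have "norm (N (of_real u - \<i> * of_real (pi / \<kappa>))) \<le> C * exp (c * \<bar>u\<bar>)"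
      using bound[of "of_real u - \<i> * of_real (pi / \<kappa>)"] \<kappa> by simp
    ultimately show "norm (N (of_real u) + N (of_real u - \<i> * of_real (pi / \<kappa>))) \<le> 2 * C * exp (c * \<bar>u\<bar>)"
      using norm_triangle_ineq[of "N (of_real u)" "N (of_real u - \<i> * of_real (pi / \<kappa>))"] by linarith
  qed
  define A where "A n = {- real n .. real n}" for n
  have UA: "(\<Union>n. A n) = UNIV"
  proof (intro equalityI subsetI UNIV_I)
    fix x :: real
    obtain n where "\<bar>x\<bar> \<le> real n" using real_arch_simple by blast
    then have "x \<in> A n" by (auto simp: A_def)
    then show "x \<in> (\<Union>n. A n)" by blast
  qed
  have si: "set_integrable lborel B ?F" if "B \<in> sets borel" for B
    unfolding set_integrable_def using int that by (intro integrable_mult_indicator) auto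
  have "(\<lambda>n. LINT x:A n|lborel. ?F x) \<longlonglongrightarrow> (LINT x:(\<Union>n. A n)|lborel. ?F x)"
  proof (rule set_integral_cont_up)
    show "set_integrable lborel (\<Union>n. A n) ?F" unfolding UA by (rule si) simp
    show "incseq A" by (auto simp: A_def incseq_def)
  qed (simp add: A_def)
  then have "(\<lambda>n. integral (A n) ?F) \<longlonglongrightarrow> (LINT x|lborel. ?F x)"
    unfolding UA using set_borel_integral_eq_integral(2)[OF si] 
    by (simp add: A_def set_lebesgue_integral_def)
  moreover have "(\<lambda>n. integral (A n) ?F) \<longlonglongrightarrow> ?L"
  proof (rule LIM_zero_cancel, rule Lim_null_comparison)
    show "\<forall>\<^sub>F n in sequentially. norm (integral (A n) ?F - ?L) \<le> 8 * pi / \<kappa> * C * exp (- (\<kappa> - c)) ^ n"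
    proof (rule eventually_mono)
      show "\<forall>\<^sub>F n in sequentially. n \<ge> max 1 (nat \<lceil>1 / \<kappa>\<rceil>)" by (rule eventually_ge_at_top)
      \<comment> \<open>The threshold ensures both n > 0 and \<kappa> n \<ge> 1, the size conditions
        on the rectangle.\<close>
      fix n assume n: "n \<ge> max 1 (nat \<lceil>1 / \<kappa>\<rceil>)"
      then have "real n \<ge> 1 / \<kappa>" by linarith
      then have "1 \<le> \<kappa> * real n" using \<kappa> by (simp add: field_simps)
      with n have "norm (integral (A n) ?F - ?L) \<le> 8 * pi / \<kappa> * C * exp (- (\<kappa> - c) * real n)"
        unfolding A_def by (intro sech_rectangle[OF \<kappa> N bound]) auto
      then show "norm (integral (A n) ?F - ?L) \<le> 8 * pi / \<kappa> * C * exp (- (\<kappa> - c)) ^ n"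
        by (simp only: exp_of_nat2_mult)
    qed
    show "(\<lambda>n. 8 * pi / \<kappa> * C * exp (- (\<kappa> - c)) ^ n) \<longlonglongrightarrow> 0"
      using c by (intro tendsto_mult_right_zero LIMSEQ_realpow_zero) auto
  qed
  ultimately show ?thesis using int LIMSEQ_unique by blast
qed

subsection \<open>The Meixner distribution\<close>

text \<open>On the line Re z = 1 / 2 the reflected point 1 - z is the conjugate of z, so the
  reflection formula computes |Gamma z|^2, and sin (pi z) becomes cosh (pi y).\<close>

lemma norm_Gamma_half_squared:
  "(norm (Gamma (1 / 2 + \<i> * of_real y)))\<^sup>2 = pi / cosh (pi * y)"
proof -
  let ?z = "1 / 2 + \<i> * of_real y"
  have "1 - ?z = cnj ?z" by (simp add: complex_eq_iff)
  then have "complex_of_real ((norm (Gamma ?z))\<^sup>2) = Gamma ?z * Gamma (1 - ?z)"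
    by (simp only: complex_norm_square cnj_Gamma)
  also have "\<dots> = of_real pi / sin (of_real pi * ?z)" by (rule Gamma_reflection_complex)
  also have "of_real pi * ?z = of_real (pi / 2) + \<i> * of_real (pi * y)"
    by (simp add: algebra_simps)
  also have "sin \<dots> = of_real (cosh (pi * y))"
    unfolding sin_add sin_of_real cos_of_real cosh_conv_cos[symmetric] by (simp flip: cosh_complex_of_real)
  finally have "complex_of_real ((norm (Gamma ?z))\<^sup>2) = of_real (pi / cosh (pi * y))"
    by simp
  then show ?thesis by (simp only: of_real_eq_iff)
qed

lemma Arg_upper_right:
  assumes "0 \<le> Re \<alpha>" "0 < Im \<alpha>"
  shows "0 < Arg \<alpha>" "Arg \<alpha> \<le> pi / 2"
    "cos (pi / 2 - Arg \<alpha>) = Im \<alpha> / norm \<alpha>" "sin (pi / 2 - Arg \<alpha>) = Re \<alpha> / norm \<alpha>"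
proof -
  have eq: "\<alpha> = rcis (norm \<alpha>) (Arg \<alpha>)" by (simp add: rcis_cmod_Arg)
  have n: "norm \<alpha> > 0" using assms by auto
  have "Re \<alpha> = norm \<alpha> * cos (Arg \<alpha>)" "Im \<alpha> = norm \<alpha> * sin (Arg \<alpha>)"
    by (subst (1) eq, simp)+
  then have cs: "cos (Arg \<alpha>) = Re \<alpha> / norm \<alpha>" "sin (Arg \<alpha>) = Im \<alpha> / norm \<alpha>"
    using n by (simp_all add: field_simps)
  then show "cos (pi / 2 - Arg \<alpha>) = Im \<alpha> / norm \<alpha>" "sin (pi / 2 - Arg \<alpha>) = Re \<alpha> / norm \<alpha>"
    by (simp_all add: cos_diff sin_diff)
  show "0 < Arg \<alpha>" using assms(2) Arg_lt_pi by blast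
  show "Arg \<alpha> \<le> pi / 2" using Arg_Re_nonneg[of \<alpha>] assms(1) by linarith
qed

text \<open>The density for \<open>\<tau> = \<eta>\<close>, recentred by \<open>u = x + Re \<alpha>\<close>.\<close>
definition meixner_density :: "complex \<Rightarrow> real \<Rightarrow> real" where
  "meixner_density \<alpha> u = cos (pi / 2 - Arg \<alpha>) / (2 * Im \<alpha>) * exp ((pi / 2 - Arg \<alpha>) * u / Im \<alpha>)
    / cosh (pi / (2 * Im \<alpha>) * u)"

text \<open>For \<tau> = \<eta> the offset in the argument of Gamma is i \<beta> / (2 Im \<alpha>),
  whose real part is 1 / 2 and whose imaginary part Re \<alpha> / (2 Im \<alpha>) accounts for the
  recentring. The constant exponential merges with exp (\<theta> x / Im \<alpha>) in the same
  way.\<close>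

lemma mu_meixner:
  assumes \<alpha>: "0 \<le> Re \<alpha>" "0 < Im \<alpha>" and \<eta>: "complex_of_real \<eta> = \<alpha> * cnj \<alpha>"
  shows "mu \<alpha> (cnj \<alpha>) \<eta> = density lborel (\<lambda>x. ennreal (meixner_density \<alpha> (x + Re \<alpha>)))"
proof -
  define \<theta> where "\<theta> = pi / 2 - Arg \<alpha>"
  define b where "b = Im \<alpha>"
  have b: "b > 0" using \<alpha> by (simp add: b_def)
  have cos: "cos \<theta> > 0" using Arg_upper_right(3)[OF \<alpha>] \<alpha> by (auto simp: \<theta>_def intro!: divide_pos_pos)
  have ne: "\<alpha> \<noteq> cnj \<alpha>" "Im \<alpha> \<noteq> 0" using \<alpha> by (auto simp: complex_eq_iff)
  have \<eta>0: "\<eta> \<noteq> 0"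
  proof
    assume "\<eta> = 0"
    then have "\<alpha> * cnj \<alpha> = 0" using \<eta> by simp
    then show False using ne by auto
  qed
  have Re: "Re (\<alpha> * cnj \<alpha>) = \<eta>" using \<eta> by (metis Re_complex_of_real)
  have "(2 * cos \<theta>) powr (\<eta> / \<eta>) / (4 * b * pi * Gamma (\<eta> / \<eta>)) * exp (\<theta> * \<eta> * Re \<alpha> / (b * \<eta>))
      * exp (\<theta> * x / b) * (norm (Gamma (\<i> * of_real x / (2 * of_real b)
        + \<i> * of_real \<eta> * cnj \<alpha> / (2 * of_real \<eta> * of_real b))))\<^sup>2 = meixner_density \<alpha> (x + Re \<alpha>)" for x
  proof -
    have "\<i> * of_real x / (2 * of_real b) + \<i> * of_real \<eta> * cnj \<alpha> / (2 * of_real \<eta> * of_real b)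
        = 1 / 2 + \<i> * of_real ((x + Re \<alpha>) / (2 * b))"
      using \<eta>0 b by (simp add: complex_eq_iff b_def field_simps)
    then have G: "(norm (Gamma (\<i> * of_real x / (2 * of_real b)
        + \<i> * of_real \<eta> * cnj \<alpha> / (2 * of_real \<eta> * of_real b))))\<^sup>2 = pi / cosh (pi / (2 * b) * (x + Re \<alpha>))"
      by (simp only: norm_Gamma_half_squared) (simp add: ac_simps)
    have e: "exp (\<theta> * \<eta> * Re \<alpha> / (b * \<eta>)) * exp (\<theta> * x / b) = exp (\<theta> * (x + Re \<alpha>) / b)"
      using \<eta>0 by (simp add: mult_exp_exp add_divide_distrib distrib_left)
    show ?thesis
      unfolding G meixner_density_def \<theta>_def[symmetric] b_def[symmetric] e[symmetric]
      using \<eta>0 cos b by (simp add: field_simps)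
  qed
  then show ?thesis
    using ne unfolding mu_def Let_def Re \<theta>_def b_def by simp
qed

text \<open>Put b = Im \<alpha>, so that \<beta> - \<alpha> = - 2 i b is exactly the distance
  between the two lines in \<open>sech_integral\<close>. This shift multiplies exp (\<theta> w / b)
  by exp (- 2 i \<theta>) = - \<alpha> / \<beta>. Hence N (u) + N (u - 2 i b) is a constant multiple
  of exp (\<theta> u / b) times (1 - \<alpha> D_h) g, and the pole halfway gives g (z - 2 i
  b).\<close>

lemma meixner_integral:
  assumes \<alpha>: "0 \<le> Re \<alpha>" "0 < Im \<alpha>" and g: "g \<in> E1min"
  shows "integrable lborel (\<lambda>u. meixner_density \<alpha> u *\<^sub>R id_minus_diff \<alpha> (cnj \<alpha>) g (z + of_real u - \<i> * of_real (Im \<alpha>))) \<and>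
    (LINT u|lborel. meixner_density \<alpha> u *\<^sub>R id_minus_diff \<alpha> (cnj \<alpha>) g (z + of_real u - \<i> * of_real (Im \<alpha>)))
      = g (z - (\<alpha> - cnj \<alpha>))"
proof -
  define \<theta> where "\<theta> = pi / 2 - Arg \<alpha>"
  define b where "b = Im \<alpha>"
  define \<kappa> where "\<kappa> = pi / (2 * b)"
  note Arg = Arg_upper_right[OF \<alpha>]
  have b: "b > 0" using \<alpha> by (simp add: b_def)
  have \<kappa>: "\<kappa> > 0" using b by (simp add: \<kappa>_def)
  have \<theta>: "0 \<le> \<theta>" using Arg by (simp add: \<theta>_def)
  have pk: "pi / \<kappa> = 2 * b" "pi / (2 * \<kappa>) = b" "2 * pi / \<kappa> = 4 * b" using b by (simp_all add: \<kappa>_def)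
  \<comment> \<open>Half of the gap \<kappa> - \<theta> / b = Arg \<alpha> / b; its positivity is
    what makes c < \<kappa>.\<close>
  define s where "s = Arg \<alpha> / (2 * b)"
  have s: "s > 0" using b Arg by (simp add: s_def)
  define c where "c = \<theta> / b + s"
  have c: "c < \<kappa>" using b Arg(1) by (simp add: c_def s_def \<theta>_def \<kappa>_def field_simps)
  define N where "N w = exp (of_real (\<theta> / b) * w) * g (z - \<i> * of_real b + w)" for w
  \<comment> \<open>Of the 3 b, one b is the offset in the argument of g and 2 b is the bound on |Im
    w|.\<close>
  define C where "C = E1norm s g * exp (s * (norm z + 3 * b))"
  have "(g \<circ> (\<lambda>w. z - \<i> * of_real b + w)) holomorphic_on UNIV"
    by (intro holomorphic_on_compose E1min_holomorphic[OF g] holomorphic_intros)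
  then have Nh: "N holomorphic_on UNIV"
    unfolding N_def o_def by (intro holomorphic_on_mult holomorphic_intros)
  have bound: "norm (N w) \<le> C * exp (c * \<bar>Re w\<bar>)" if "\<bar>Im w\<bar> \<le> pi / \<kappa>" for w
  proof -
    have "norm (z - \<i> * of_real b + w) \<le> norm z + norm (\<i> * of_real b) + norm w"
      using norm_triangle_ineq[of "z - \<i> * of_real b" w] norm_triangle_ineq4[of z "\<i> * of_real b"] by linarith
    also have "norm w \<le> \<bar>Re w\<bar> + 2 * b" using cmod_le[of w] that pk(1) by linarith
    finally have n: "norm (z - \<i> * of_real b + w) \<le> \<bar>Re w\<bar> + (norm z + 3 * b)" using b by (simp add: norm_mult)
    have "norm (g (z - \<i> * of_real b + w)) \<le> E1norm s g * exp (s * norm (z - \<i> * of_real b + w))"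
      by (rule E1min_norm_le[OF g s])
    also have "\<dots> \<le> E1norm s g * exp (s * (\<bar>Re w\<bar> + (norm z + 3 * b)))"
      using n s by (intro mult_left_mono E1norm_nonneg g) auto
    finally have "norm (g (z - \<i> * of_real b + w)) \<le> C * exp (s * \<bar>Re w\<bar>)"
      by (simp add: C_def distrib_left exp_add ac_simps)
    moreover have "norm (exp (of_real (\<theta> / b) * w)) \<le> exp (\<theta> / b * \<bar>Re w\<bar>)"
      using \<theta> b by (auto simp: norm_exp_eq_Re intro!: mult_left_mono divide_right_mono)
    ultimately have "norm (N w) \<le> exp (\<theta> / b * \<bar>Re w\<bar>) * (C * exp (s * \<bar>Re w\<bar>))"
      unfolding N_def norm_mult by (intro mult_mono) auto
    also have "\<dots> = C * exp (c * \<bar>Re w\<bar>)" by (simp add: c_def distrib_right exp_add)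
    finally show ?thesis .
  qed
  \<comment> \<open>The factor cos \<theta> / (2 b) of the density times \<beta> / (\<beta> -
    \<alpha>), with \<beta> the conjugate of \<alpha>.\<close>
  define K where "K = - cnj \<alpha> * of_real (cos \<theta>) / (4 * \<i> * of_real (b\<^sup>2))"
  have d: "cnj \<alpha> - \<alpha> = - (2 * \<i> * of_real b)" by (simp add: complex_eq_iff b_def)
  have polar: "\<alpha> = \<i> * of_real (norm \<alpha>) * exp (- \<i> * of_real \<theta>)" "cnj \<alpha> = - \<i> * of_real (norm \<alpha>) * exp (\<i> * of_real \<theta>)"
  proof -
    have n: "norm \<alpha> \<noteq> 0" using \<alpha> by auto
    have e: "exp (- \<i> * of_real \<theta>) = cis (- \<theta>)" "exp (\<i> * of_real \<theta>) = cis \<theta>" by (simp_all add: cis_conv_exp)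
    show "\<alpha> = \<i> * of_real (norm \<alpha>) * exp (- \<i> * of_real \<theta>)" "cnj \<alpha> = - \<i> * of_real (norm \<alpha>) * exp (\<i> * of_real \<theta>)"
      unfolding e using Arg(3,4)[folded \<theta>_def] n by (simp_all add: complex_eq_iff)
  qed
  have int_eq: "meixner_density \<alpha> u *\<^sub>R id_minus_diff \<alpha> (cnj \<alpha>) g (z + of_real u - \<i> * of_real b)
      = K * ((N (of_real u) + N (of_real u - \<i> * of_real (pi / \<kappa>))) / of_real (cosh (\<kappa> * u)))" for u
  proof -
    define v where "v = z + of_real u - \<i> * of_real b"
    have v: "z - \<i> * of_real b + of_real u = v" "z - \<i> * of_real b + (of_real u - \<i> * of_real (2 * b)) = v + (cnj \<alpha> - \<alpha>)"
      by (simp_all add: v_def d)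
    define E where "E = exp (of_real (\<theta> * u / b) :: complex)"
    have E: "exp (of_real (\<theta> / b) * of_real u) = E" by (simp add: E_def)
    have "of_real (\<theta> / b) * (of_real u - \<i> * of_real (2 * b)) = of_real (\<theta> * u / b) + (- \<i> * of_real \<theta>) + (- \<i> * of_real \<theta>)"
      using b by (simp add: field_simps)
    then have E2: "exp (of_real (\<theta> / b) * (of_real u - \<i> * of_real (2 * b))) = E * exp (- \<i> * of_real \<theta>) * exp (- \<i> * of_real \<theta>)"
      by (simp only: E_def exp_add)
    have one: "exp (\<i> * of_real \<theta>) * exp (- \<i> * of_real \<theta>) = 1" by (simp flip: exp_add)
    have "cnj \<alpha> * (exp (- \<i> * of_real \<theta>) * exp (- \<i> * of_real \<theta>))
        = - \<i> * of_real (norm \<alpha>) * (exp (\<i> * of_real \<theta>) * exp (- \<i> * of_real \<theta>)) * exp (- \<i> * of_real \<theta>)"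
      by (subst polar(2)) (simp only: ac_simps)
    also have "\<dots> = - \<alpha>" unfolding one by (subst (2) polar(1)) simp
    finally have quot: "cnj \<alpha> * (exp (- \<i> * of_real \<theta>) * exp (- \<i> * of_real \<theta>)) = - \<alpha>" .
    have "cnj \<alpha> * (N (of_real u) + N (of_real u - \<i> * of_real (2 * b)))
        = E * (cnj \<alpha> * g v + cnj \<alpha> * (exp (- \<i> * of_real \<theta>) * exp (- \<i> * of_real \<theta>)) * g (v + (cnj \<alpha> - \<alpha>)))"
      unfolding N_def v E E2 by (simp add: algebra_simps)
    also have "\<dots> = E * (cnj \<alpha> * g v - \<alpha> * g (v + (cnj \<alpha> - \<alpha>)))" unfolding quot by simp
    also have "\<dots> = - (2 * \<i> * of_real b) * E * id_minus_diff \<alpha> (cnj \<alpha>) g v"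
    proof -
      have nz: "cnj \<alpha> - \<alpha> \<noteq> 0" unfolding d using b by simp
      have "(cnj \<alpha> - \<alpha>) * id_minus_diff \<alpha> (cnj \<alpha>) g v = cnj \<alpha> * g v - \<alpha> * g (v + (cnj \<alpha> - \<alpha>))"
        unfolding id_minus_diff_def diffop_def using nz by (simp add: field_simps)
      then show ?thesis unfolding d[symmetric] by (simp only: ac_simps)
    qed
    finally have NN: "cnj \<alpha> * (N (of_real u) + N (of_real u - \<i> * of_real (2 * b)))
        = - (2 * \<i> * of_real b) * E * id_minus_diff \<alpha> (cnj \<alpha>) g v" .
    have "K * ((N (of_real u) + N (of_real u - \<i> * of_real (2 * b))) / of_real (cosh (\<kappa> * u)))
        = - of_real (cos \<theta>) / (4 * \<i> * of_real (b\<^sup>2)) * (cnj \<alpha> * (N (of_real u) + N (of_real u - \<i> * of_real (2 * b)))) / of_real (cosh (\<kappa> * u))"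
      by (simp add: K_def)
    also have "\<dots> = of_real (cos \<theta> / (2 * b)) * E * id_minus_diff \<alpha> (cnj \<alpha>) g v / of_real (cosh (\<kappa> * u))"
      unfolding NN using b by (simp add: field_simps power2_eq_square)
    also have "\<dots> = meixner_density \<alpha> u *\<^sub>R id_minus_diff \<alpha> (cnj \<alpha>) g v"
      unfolding meixner_density_def scaleR_conv_of_real E_def exp_of_real
      by (simp add: \<theta>_def b_def \<kappa>_def)
    finally show ?thesis unfolding pk(1) v_def by simp
  qed
  \<comment> \<open>The pole is at - i b, which contributes exp (- i \<theta>); all constants cancel
    because |\<alpha>| cos \<theta> = b.\<close>
  have val: "K * (of_real (2 * pi / \<kappa>) * N (- \<i> * of_real (pi / (2 * \<kappa>)))) = g (z - (\<alpha> - cnj \<alpha>))"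
  proof -
    have "of_real (\<theta> / b) * (- \<i> * of_real b) = - \<i> * of_real \<theta>" using b by simp
    moreover have "z - \<i> * of_real b + - \<i> * of_real b = z - (\<alpha> - cnj \<alpha>)"
      using d by (simp add: algebra_simps)
    ultimately have N: "N (- \<i> * of_real (pi / (2 * \<kappa>))) = exp (- \<i> * of_real \<theta>) * g (z - (\<alpha> - cnj \<alpha>))"
      unfolding N_def pk(2) by (simp only:)
    have "cnj \<alpha> * exp (- \<i> * of_real \<theta>) = - \<i> * of_real (norm \<alpha>)"
      by (subst polar(2)) (simp add: exp_minus)
    moreover have "norm \<alpha> * cos \<theta> = b" using Arg(3) \<alpha> by (auto simp: \<theta>_def b_def)
    ultimately have "cnj \<alpha> * of_real (cos \<theta>) * exp (- \<i> * of_real \<theta>) = - \<i> * of_real b"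
      by (metis (no_types, lifting) mult.assoc mult.commute of_real_mult)
    then have "K * (of_real (2 * pi / \<kappa>) * exp (- \<i> * of_real \<theta>)) = 1"
      unfolding K_def pk(3) using b by (simp add: field_simps power2_eq_square)
    then show ?thesis unfolding N by (metis mult.assoc mult_1)
  qed
  let ?F = "\<lambda>u. (N (of_real u) + N (of_real u - \<i> * of_real (pi / \<kappa>))) / of_real (cosh (\<kappa> * u))"
  have sech: "integrable lborel ?F \<and> integral\<^sup>L lborel ?F = of_real (2 * pi / \<kappa>) * N (- \<i> * of_real (pi / (2 * \<kappa>)))"
    by (rule sech_integral[OF \<kappa> c Nh bound])
  have "integrable lborel (\<lambda>u. K * ?F u)"
    by (rule integrable_mult_right) (rule conjunct1[OF sech])
  then show ?thesis
    unfolding b_def[symmetric] int_eq integral_mult_right_zero conjunct2[OF sech] val by blast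
qed

lemma Vop_meixner:
  assumes \<alpha>: "0 \<le> Re \<alpha>" "0 < Im \<alpha>" and \<eta>: "complex_of_real \<eta> = \<alpha> * cnj \<alpha>" and f: "f \<in> E1min"
  shows "integrable (mu \<alpha> (cnj \<alpha>) \<eta>)
      (\<lambda>x. \<alpha> / cnj \<alpha> * f (z + of_real x + cnj \<alpha>) - (\<alpha> - cnj \<alpha>) / cnj \<alpha> * f z) \<and>
    Vop \<sigma> \<alpha> (cnj \<alpha>) f z = (LINT x|mu \<alpha> (cnj \<alpha>) \<eta>.
      \<alpha> / cnj \<alpha> * f (z + of_real x + cnj \<alpha>) - (\<alpha> - cnj \<alpha>) / cnj \<alpha> * f z)"
proof (rule Vop_integral_representation[OF f])
  show "\<alpha> \<noteq> cnj \<alpha>" "cnj \<alpha> \<noteq> 0" using \<alpha> by (auto simp: complex_eq_iff)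
  fix g assume g: "g \<in> E1min"
  let ?k = "id_minus_diff \<alpha> (cnj \<alpha>) g"
  let ?F = "\<lambda>u. meixner_density \<alpha> u *\<^sub>R ?k (z + of_real u - \<i> * of_real (Im \<alpha>))"
  \<comment> \<open>In the variable u = x + Re \<alpha> the argument z + x + \<beta> is z + u - i Im
    \<alpha>. The form \<open>1 * x\<close> fits the affine substitution rule for
    \<open>lborel\<close>.\<close>
  have shift: "meixner_density \<alpha> (x + Re \<alpha>) *\<^sub>R ?k (z + of_real x + cnj \<alpha>) = ?F (Re \<alpha> + 1 * x)" for x
  proof -
    have "z + of_real x + cnj \<alpha> = z + of_real (Re \<alpha> + 1 * x) - \<i> * of_real (Im \<alpha>)"
      by (simp add: complex_eq_iff)
    moreover have "x + Re \<alpha> = Re \<alpha> + 1 * x" by simp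
    ultimately show ?thesis by (simp only:)
  qed
  have "continuous_on UNIV (\<lambda>x. meixner_density \<alpha> (x + Re \<alpha>))"
    unfolding meixner_density_def by (intro continuous_intros) (use \<alpha> in auto)
  then have m1: "(\<lambda>x. meixner_density \<alpha> (x + Re \<alpha>)) \<in> borel_measurable lborel"
    using borel_measurable_continuous_onI by simp
  have m2: "AE x in lborel. 0 \<le> meixner_density \<alpha> (x + Re \<alpha>)"
    unfolding meixner_density_def using Arg_upper_right(3)[OF \<alpha>] \<alpha>
    by (intro AE_I2) (simp add: cosh_real_pos less_imp_le)
  have m3: "(\<lambda>x. ?k (z + of_real x + cnj \<alpha>)) \<in> borel_measurable lborel"
    using E1min_borel_measurable[OF id_minus_diff_E1min[OF g, of \<alpha> "cnj \<alpha>"], of "z + cnj \<alpha>"]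
    by (simp add: ac_simps)
  have "integrable lborel ?F" "(LINT u|lborel. ?F u) = g (z - (\<alpha> - cnj \<alpha>))"
    using meixner_integral[OF \<alpha> g, of z] by auto
  then show "integrable (mu \<alpha> (cnj \<alpha>) \<eta>) (\<lambda>x. ?k (z + of_real x + cnj \<alpha>)) \<and>
      (LINT x|mu \<alpha> (cnj \<alpha>) \<eta>. ?k (z + of_real x + cnj \<alpha>)) = g (z - (\<alpha> - cnj \<alpha>))"
    unfolding mu_meixner[OF \<alpha> \<eta>] integrable_density[OF m3 m1 m2] integral_density[OF m3 m1 m2] shift
    using lborel_integral_real_affine[of 1 ?F "Re \<alpha>"] lborel_integrable_real_affine[of ?F 1 "Re \<alpha>"]
    by simp
qed

text \<open>The integrability conjuncts give the integrals their content, because the Bochner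
  integral of a non-integrable function defaults to 0. Bijectivity makes \<open>inv_into\<close> a
  genuine inverse.\<close>

theorem proposition3p13:
  fixes \<sigma> \<eta> :: real and \<alpha> \<beta> :: complex and f :: "complex \<Rightarrow> complex"
  assumes "0 < \<sigma>"
    and "(0 < \<beta> \<and> \<beta> \<le> \<alpha>) \<or> (0 \<le> Re \<alpha> \<and> 0 < Im \<alpha> \<and> \<beta> = cnj \<alpha>)"
    and "complex_of_real \<eta> = \<alpha> * \<beta>"
    and "f \<in> E1min"
  shows
    "bij_betw (id_minus_diff \<alpha> \<beta>) E1min E1min \<and>
     Vop \<sigma> \<alpha> \<beta> f = inv_into E1min (id_minus_diff \<alpha> \<beta>) f \<and>
     (\<alpha> = \<beta> \<and> 0 < \<beta> \<longrightarrow> (\<forall>z.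
        set_integrable (mu \<alpha> \<alpha> \<eta>) {0<..} (\<lambda>x. f (z + of_real x)) \<and>
        Vop \<sigma> \<alpha> \<beta> f z = (LINT x:{0<..}|mu \<alpha> \<alpha> \<eta>. f (z + of_real x)))) \<and>
     (0 < \<beta> \<and> \<beta> < \<alpha> \<longrightarrow> (\<forall>z.
        set_integrable (mu \<alpha> \<beta> \<eta>) (range (\<lambda>n. Re (\<alpha> - \<beta>) * real n))
          (\<lambda>x. \<alpha> / \<beta> * f (z + of_real x) - (\<alpha> - \<beta>) / \<beta> * f z) \<and>
        Vop \<sigma> \<alpha> \<beta> f z = (LINT x:range (\<lambda>n. Re (\<alpha> - \<beta>) * real n)|mu \<alpha> \<beta> \<eta>.
          \<alpha> / \<beta> * f (z + of_real x) - (\<alpha> - \<beta>) / \<beta> * f z))) \<and>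
     (0 \<le> Re \<alpha> \<and> 0 < Im \<alpha> \<and> \<beta> = cnj \<alpha> \<longrightarrow> (\<forall>z.
        integrable (mu \<alpha> \<beta> \<eta>)
          (\<lambda>x. \<alpha> / \<beta> * f (z + of_real x + \<beta>) - (\<alpha> - \<beta>) / \<beta> * f z) \<and>
        Vop \<sigma> \<alpha> \<beta> f z = (LINT x|mu \<alpha> \<beta> \<eta>.
          \<alpha> / \<beta> * f (z + of_real x + \<beta>) - (\<alpha> - \<beta>) / \<beta> * f z)))"
proof -
  note f = assms(4)
  have gamma: "set_integrable (mu \<alpha> \<alpha> \<eta>) {0<..} (\<lambda>x. f (z + of_real x)) \<and>
      Vop \<sigma> \<alpha> \<beta> f z = (LINT x:{0<..}|mu \<alpha> \<alpha> \<eta>. f (z + of_real x))"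
    if "\<alpha> = \<beta> \<and> 0 < \<beta>" for z
  proof -
    define a where "a = Re \<beta>"
    \<comment> \<open>The order on \<open>complex\<close> compares only numbers with equal imaginary
      parts, so 0 < \<beta> makes \<beta> real.\<close>
    have a: "\<alpha> = of_real a" "\<beta> = of_real a" "a > 0"
      using that by (auto simp: a_def less_complex_def complex_eq_iff)
    have "complex_of_real \<eta> = of_real (a * a)" using assms(3) by (simp add: a)
    then have "\<eta> = a * a" by (simp only: of_real_eq_iff)
    then show ?thesis using Vop_gamma[OF a(3) f, of z \<sigma>] by (simp only: a(1,2))
  qed
  have neg_binomial: "set_integrable (mu \<alpha> \<beta> \<eta>) (range (\<lambda>n. Re (\<alpha> - \<beta>) * real n))
          (\<lambda>x. \<alpha> / \<beta> * f (z + of_real x) - (\<alpha> - \<beta>) / \<beta> * f z) \<and>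
        Vop \<sigma> \<alpha> \<beta> f z = (LINT x:range (\<lambda>n. Re (\<alpha> - \<beta>) * real n)|mu \<alpha> \<beta> \<eta>.
          \<alpha> / \<beta> * f (z + of_real x) - (\<alpha> - \<beta>) / \<beta> * f z)"
    if "0 < \<beta> \<and> \<beta> < \<alpha>" for z
  proof -
    define a b where "a = Re \<alpha>" and "b = Re \<beta>"
    have ab: "\<alpha> = of_real a" "\<beta> = of_real b" "0 < b" "b < a"
      using that by (auto simp: a_def b_def less_complex_def complex_eq_iff)
    have "complex_of_real \<eta> = of_real (a * b)" using assms(3) by (simp add: ab)
    then have "\<eta> = a * b" by (simp only: of_real_eq_iff)
    moreover have "Re (\<alpha> - \<beta>) = a - b" by (simp add: a_def b_def)
    ultimately show ?thesis using Vop_negative_binomial[OF ab(3,4) f, of z \<sigma>] by (simp only: ab(1,2))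
  qed
  have meixner: "integrable (mu \<alpha> \<beta> \<eta>)
          (\<lambda>x. \<alpha> / \<beta> * f (z + of_real x + \<beta>) - (\<alpha> - \<beta>) / \<beta> * f z) \<and>
        Vop \<sigma> \<alpha> \<beta> f z = (LINT x|mu \<alpha> \<beta> \<eta>.
          \<alpha> / \<beta> * f (z + of_real x + \<beta>) - (\<alpha> - \<beta>) / \<beta> * f z)"
    if "0 \<le> Re \<alpha> \<and> 0 < Im \<alpha> \<and> \<beta> = cnj \<alpha>" for z
  proof -
    have "complex_of_real \<eta> = \<alpha> * cnj \<alpha>" using assms(3) that by simp
    then show ?thesis using Vop_meixner[OF _ _ _ f, of \<alpha> \<eta> z \<sigma>] that by (simp only: simp_thms)
  qed
  show ?thesis
    by (intro conjI impI allI bij_betw_id_minus_diff Vop_eq_inv_into f)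
      (use gamma neg_binomial meixner in blast)+
qed

end
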